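(* Let $\Gamma=(V,E)$ be an infinite weighted graph. The top of the spectrum $\overline\lambda(\Gamma)=\sup\sigma(\Delta)$ of its normalized Laplace operator satisfies $$2\bar h(\Gamma)+h(\Gamma)\le\overline\lambda(\Gamma)\le 1+\sqrt{1-(1-\bar h(\Gamma))^2}.$$
   Context: $\Gamma=(V,E)$ is a locally finite, connected graph with infinitely many vertices, equipped with symmetric edge weights $\mu_{xy}=\mu_{yx}\ge 0$, where $\mu_{xy}>0$ iff $(x,y)\in E$; self-loops ($\mu_{xx}>0$) are allowed. Put $\mu(x)=\sum_{y\in V}\mu_{xy}$. For finite $U\subset V$: $\mathrm{vol}(U)=\sum_{x\in U}\mu(x)$, $|\partial U|=\sum_{x\in U}\sum_{y\notin U}\mu_{xy}$; for finite $V_1,V_2\subset V$: $|E(V_1,V_2)|=\sum_{x\in V_1}\sum_{y\in V_2}\mu_{xy}$. For $\Omega\subset V$: $h(\Omega)=\inf\{|\partial U|/\mathrm{vol}(U):\emptyset\neq U\subset\Omega,\ U\text{ finite}\}$ and $\bar h(\Omega)=\sup\left\{\frac{2|E(V_1,V_2)|}{\mathrm{vol}(V_1)+\mathrm{vol}(V_2)}\right\}$ over pairs of disjoint nonempty finite $V_1,V_2\subset\Omega$. $h(\Gamma)=\lim_{\Omega\uparrow\Gamma}h(\Omega)$ and $\bar h(\Gamma)=\lim_{\Omega\uparrow\Gamma}\bar h(\Omega)$ along any increasing sequence of finite subsets exhausting $V$ (equivalently, $h(V)$ and $\bar h(V)$). The normalized Laplace operator is the bounded self-adjoint operator on $\ell^2(V,\mu)$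 (inner product $\sum_x\mu(x)f(x)g(x)$) given by $\Delta f(x)=f(x)-\frac1{\mu(x)}\sum_{y}\mu_{xy}f(y)$; $\sigma(\Delta)$ is its spectrum. *)

theory Defs
  imports "HOL-Analysis.Analysis"
begin

section \<open>Infinite weighted graphs\<close>

text \<open>
  Vertices form a set \<open>V\<close>, so only the values of \<open>w\<close> on \<open>V \<times> V\<close> matter. Self-loops
  \<open>(x, x) \<in> E\<close> are allowed.
\<close>

locale infinite_weighted_graph =
  fixes V :: "'a set" and E :: "('a \<times> 'a) set" and w :: "'a \<Rightarrow> 'a \<Rightarrow> real"
  assumes edges: "E \<subseteq> V \<times> V"
    and infinite: "infinite V"
    and weight_sym: "\<lbrakk>x \<in> V; y \<in> V\<rbrakk> \<Longrightarrow> w x y = w y x"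
    and weight_nonneg: "\<lbrakk>x \<in> V; y \<in> V\<rbrakk> \<Longrightarrow> 0 \<le> w x y"
    and weight_pos_iff: "\<lbrakk>x \<in> V; y \<in> V\<rbrakk> \<Longrightarrow> 0 < w x y \<longleftrightarrow> (x, y) \<in> E"
    and locally_finite: "x \<in> V \<Longrightarrow> finite {y. (x, y) \<in> E}"
    and connected: "\<lbrakk>x \<in> V; y \<in> V\<rbrakk> \<Longrightarrow> (x, y) \<in> E\<^sup>*"

definition vertex_weight :: "'a set \<Rightarrow> ('a \<Rightarrow> 'a \<Rightarrow> real) \<Rightarrow> 'a \<Rightarrow> real"
  where "vertex_weight V w x = (\<Sum>\<^sub>\<infinity>y\<in>V. w x y)"

definition vol :: "'a set \<Rightarrow> ('a \<Rightarrow> 'a \<Rightarrow> real) \<Rightarrow> 'a set \<Rightarrow> real"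
  where "vol V w U = (\<Sum>x\<in>U. vertex_weight V w x)"

definition boundary_size :: "'a set \<Rightarrow> ('a \<Rightarrow> 'a \<Rightarrow> real) \<Rightarrow> 'a set \<Rightarrow> real"
  where "boundary_size V w U = (\<Sum>x\<in>U. \<Sum>\<^sub>\<infinity>y\<in>V - U. w x y)"

definition edge_weight :: "('a \<Rightarrow> 'a \<Rightarrow> real) \<Rightarrow> 'a set \<Rightarrow> 'a set \<Rightarrow> real"
  where "edge_weight w V\<^sub>1 V\<^sub>2 = (\<Sum>x\<in>V\<^sub>1. \<Sum>y\<in>V\<^sub>2. w x y)"


section \<open>The Cheeger constant and the dual Cheeger constant\<close>

text \<open>
  The infimum is over the empty set when \<open>\<Omega>\<close> is empty, and the supremum when \<open>\<Omega>\<close> has fewer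
  than two elements; the values are then unspecified reals. This does not affect the limits
  along exhaustions of an infinite graph.
\<close>

definition cheeger :: "'a set \<Rightarrow> ('a \<Rightarrow> 'a \<Rightarrow> real) \<Rightarrow> 'a set \<Rightarrow> real"
  where "cheeger V w \<Omega> =
    Inf {boundary_size V w U / vol V w U | U. U \<noteq> {} \<and> U \<subseteq> \<Omega> \<and> finite U}"

definition dual_cheeger :: "'a set \<Rightarrow> ('a \<Rightarrow> 'a \<Rightarrow> real) \<Rightarrow> 'a set \<Rightarrow> real"
  where "dual_cheeger V w \<Omega> =
    Sup {2 * edge_weight w V\<^sub>1 V\<^sub>2 / (vol V w V\<^sub>1 + vol V w V\<^sub>2) | V\<^sub>1 V\<^sub>2.
      V\<^sub>1 \<noteq> {} \<and> V\<^sub>2 \<noteq> {} \<and> V\<^sub>1 \<inter> V\<^sub>2 = {} \<and> V\<^sub>1 \<subseteq> \<Omega> \<and> V\<^sub>2 \<subseteq> \<Omega> \<and> finite V\<^sub>1 \<and> finite V\<^sub>2}"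

definition exhaustion :: "'a set \<Rightarrow> (nat \<Rightarrow> 'a set) \<Rightarrow> bool"
  where "exhaustion V \<Omega> \<longleftrightarrow> incseq \<Omega> \<and> (\<forall>n. finite (\<Omega> n)) \<and> (\<Union>n. \<Omega> n) = V"

text \<open>
  The common limit of \<open>F\<close> along all exhaustions of \<open>V\<close>. For the two constants below it exists
  and is unique, see \<open>exhaustion_exists\<close>, \<open>cheeger_graph_limit\<close> and
  \<open>dual_cheeger_graph_limit\<close>.
\<close>

definition exhaustion_lim :: "'a set \<Rightarrow> ('a set \<Rightarrow> real) \<Rightarrow> real"
  where "exhaustion_lim V F = (THE l. \<forall>\<Omega>. exhaustion V \<Omega> \<longrightarrow> (\<lambda>n. F (\<Omega> n)) \<longlonglongrightarrow> l)"

definition cheeger_graph :: "'a set \<Rightarrow> ('a \<Rightarrow> 'a \<Rightarrow> real) \<Rightarrow> real"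
  where "cheeger_graph V w = exhaustion_lim V (cheeger V w)"

definition dual_cheeger_graph :: "'a set \<Rightarrow> ('a \<Rightarrow> 'a \<Rightarrow> real) \<Rightarrow> real"
  where "dual_cheeger_graph V w = exhaustion_lim V (dual_cheeger V w)"


section \<open>The normalized Laplace operator and its spectrum\<close>

text \<open>
  Functions on \<open>V\<close> are represented by functions on the whole type that vanish outside \<open>V\<close>.
\<close>

definition l2_space :: "'a set \<Rightarrow> ('a \<Rightarrow> 'a \<Rightarrow> real) \<Rightarrow> ('a \<Rightarrow> real) set"
  where "l2_space V w =
    {f. (\<forall>x. x \<notin> V \<longrightarrow> f x = 0) \<and> (\<lambda>x. vertex_weight V w x * (f x)\<^sup>2) summable_on V}"

definition l2_inner :: "'a set \<Rightarrow> ('a \<Rightarrow> 'a \<Rightarrow> real) \<Rightarrow> ('a \<Rightarrow> real) \<Rightarrow> ('a \<Rightarrow> real) \<Rightarrow> real"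
  where "l2_inner V w f g = (\<Sum>\<^sub>\<infinity>x\<in>V. vertex_weight V w x * f x * g x)"

definition l2_norm :: "'a set \<Rightarrow> ('a \<Rightarrow> 'a \<Rightarrow> real) \<Rightarrow> ('a \<Rightarrow> real) \<Rightarrow> real"
  where "l2_norm V w f = sqrt (l2_inner V w f f)"

definition l2_bounded_operator ::
    "'a set \<Rightarrow> ('a \<Rightarrow> 'a \<Rightarrow> real) \<Rightarrow> (('a \<Rightarrow> real) \<Rightarrow> ('a \<Rightarrow> real)) \<Rightarrow> bool"
  where "l2_bounded_operator V w T \<longleftrightarrow>
    T \<in> l2_space V w \<rightarrow> l2_space V w \<and>
    (\<forall>f\<in>l2_space V w. \<forall>g\<in>l2_space V w. \<forall>a b.
      T (\<lambda>x. a * f x + b * g x) = (\<lambda>x. a * T f x + b * T g x)) \<and>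
    (\<exists>C. \<forall>f\<in>l2_space V w. l2_norm V w (T f) \<le> C * l2_norm V w f)"

text \<open>
  \<open>\<lambda>\<close> is in the spectrum of \<open>T\<close> iff \<open>T - \<lambda>\<close> has no bounded two-sided inverse. Real \<open>\<lambda>\<close> are
  enough here, since the operator of interest is self-adjoint.
\<close>

definition l2_spectrum ::
    "'a set \<Rightarrow> ('a \<Rightarrow> 'a \<Rightarrow> real) \<Rightarrow> (('a \<Rightarrow> real) \<Rightarrow> ('a \<Rightarrow> real)) \<Rightarrow> real set"
  where "l2_spectrum V w T =
    {l. \<not> (\<exists>R. l2_bounded_operator V w R \<and>
      (\<forall>f\<in>l2_space V w. R (\<lambda>x. T f x - l * f x) = f \<and> (\<lambda>x. T (R f) x - l * R f x) = f))}"

definition laplacian :: "'a set \<Rightarrow> ('a \<Rightarrow> 'a \<Rightarrow> real) \<Rightarrow> ('a \<Rightarrow> real) \<Rightarrow> ('a \<Rightarrow> real)"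
  where "laplacian V w f x =
    (if x \<in> V then f x - 1 / vertex_weight V w x * (\<Sum>\<^sub>\<infinity>y\<in>V. w x y * f y) else 0)"

definition top_of_spectrum :: "'a set \<Rightarrow> ('a \<Rightarrow> 'a \<Rightarrow> real) \<Rightarrow> real"
  where "top_of_spectrum V w = Sup (l2_spectrum V w (laplacian V w))"


section \<open>Well-definedness of the limits along exhaustions\<close>

lemma finite_subset_exhaustion:
  assumes "exhaustion V \<Omega>" "finite U" "U \<subseteq> V"
  shows "\<forall>\<^sub>F n in sequentially. U \<subseteq> \<Omega> n"
proof -
  have "\<forall>x\<in>U. \<forall>\<^sub>F n in sequentially. x \<in> \<Omega> n"
  proof
    fix x assume "x \<in> U"
    then obtain m where m: "x \<in> \<Omega> m" using assms unfolding exhaustion_def by blast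
    show "\<forall>\<^sub>F n in sequentially. x \<in> \<Omega> n"
      using eventually_ge_at_top[of m]
    proof eventually_elim
      case (elim n)
      then have "\<Omega> m \<subseteq> \<Omega> n" using assms(1) unfolding exhaustion_def incseq_def by blast
      then show ?case using m by blast
    qed
  qed
  then have "\<forall>\<^sub>F n in sequentially. \<forall>x\<in>U. x \<in> \<Omega> n"
    using assms(2) by (simp add: eventually_ball_finite)
  then show ?thesis by (simp add: subset_eq)
qed

lemma tendsto_Inf_subsets:
  fixes S :: "real set"
  assumes "S \<noteq> {}" "bdd_below S" "\<And>n. A n \<subseteq> S"
    and ev: "\<And>a. a \<in> S \<Longrightarrow> \<forall>\<^sub>F n in sequentially. a \<in> A n"
  shows "(\<lambda>n. Inf (A n)) \<longlonglongrightarrow> Inf S"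
proof (rule order_tendstoI)
  fix a assume a: "a < Inf S"
  obtain s where "s \<in> S" using assms(1) by blast
  from ev[OF this] show "\<forall>\<^sub>F n in sequentially. a < Inf (A n)"
  proof eventually_elim
    case (elim n)
    then have "A n \<noteq> {}" by blast
    then have "Inf S \<le> Inf (A n)" using assms(2,3) by (intro cInf_superset_mono) auto
    then show ?case using a by simp
  qed
next
  fix a assume "Inf S < a"
  then obtain s where s: "s \<in> S" "s < a" using assms(1,2) by (auto simp: cInf_less_iff)
  from ev[OF s(1)] show "\<forall>\<^sub>F n in sequentially. Inf (A n) < a"
  proof eventually_elim
    case (elim n)
    have "bdd_below (A n)" by (rule bdd_below_mono[OF assms(2,3)])
    then have "Inf (A n) \<le> s" using elim by (rule cInf_lower[rotated])
    then show ?case using s by simp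
  qed
qed

lemma tendsto_Sup_subsets:
  fixes S :: "real set"
  assumes "S \<noteq> {}" "bdd_above S" "\<And>n. A n \<subseteq> S"
    and ev: "\<And>a. a \<in> S \<Longrightarrow> \<forall>\<^sub>F n in sequentially. a \<in> A n"
  shows "(\<lambda>n. Sup (A n)) \<longlonglongrightarrow> Sup S"
proof (rule order_tendstoI)
  fix a assume a: "Sup S < a"
  obtain s where "s \<in> S" using assms(1) by blast
  from ev[OF this] show "\<forall>\<^sub>F n in sequentially. Sup (A n) < a"
  proof eventually_elim
    case (elim n)
    then have "A n \<noteq> {}" by blast
    then have "Sup (A n) \<le> Sup S" using assms(2,3) by (intro cSup_subset_mono) auto
    then show ?case using a by simp
  qed
next
  fix a assume "a < Sup S"
  then obtain s where s: "s \<in> S" "a < s" using assms(1,2) by (auto simp: less_cSup_iff)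
  from ev[OF s(1)] show "\<forall>\<^sub>F n in sequentially. a < Sup (A n)"
  proof eventually_elim
    case (elim n)
    have "bdd_above (A n)" by (rule bdd_above_mono[OF assms(2,3)])
    then have "s \<le> Sup (A n)" using elim by (rule cSup_upper[rotated])
    then show ?case using s by simp
  qed
qed

context infinite_weighted_graph
begin

lemma exhaustion_exists: "\<exists>\<Omega>. exhaustion V \<Omega>"
proof -
  obtain x0 where x0: "x0 \<in> V" using infinite by fastforce
  define S where "S n = {y. (x0, y) \<in> E ^^ n}" for n
  have S: "finite (S n) \<and> S n \<subseteq> V" for n
  proof (induction n)
    case 0
    have "S 0 = {x0}" by (auto simp: S_def)
    then show ?case using x0 by simp
  next
    case (Suc n)
    have "S (Suc n) = (\<Union>x\<in>S n. {y. (x, y) \<in> E})" by (auto simp: S_def)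
    then show ?case using Suc locally_finite edges by auto
  qed
  have "V = (\<Union>n. S n)"
    using S connected[OF x0] by (fastforce simp: S_def rtrancl_power)
  then have "exhaustion V (\<lambda>n. \<Union>k\<le>n. S k)"
    using S unfolding exhaustion_def incseq_def by fastforce
  then show ?thesis by blast
qed

lemma weight_sum:
  assumes "x \<in> V" "A \<subseteq> V"
  shows "w x summable_on A" and "finite F \<Longrightarrow> F \<subseteq> A \<Longrightarrow> sum (w x) F \<le> infsum (w x) A"
proof -
  have "w x summable_on (A \<inter> {y. (x, y) \<in> E})"
    using locally_finite[OF assms(1)] by (intro summable_on_finite) auto
  moreover have "w x y = 0" if "y \<in> A - {y. (x, y) \<in> E}" for y
    using weight_nonneg[of x y] weight_pos_iff[of x y] that assms by force
  ultimately show *: "w x summable_on A"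
    by (subst summable_on_cong_neutral[where T = "A \<inter> {y. (x, y) \<in> E}" and g = "w x"]) auto
  show "sum (w x) F \<le> infsum (w x) A" if "finite F" "F \<subseteq> A"
    using * that assms weight_nonneg by (intro finite_sum_le_infsum) auto
qed

lemma vol_nonneg: "U \<subseteq> V \<Longrightarrow> 0 \<le> vol V w U"
  unfolding vol_def vertex_weight_def
  by (intro sum_nonneg infsum_nonneg) (auto intro: weight_nonneg)

lemma boundary_size_nonneg: "U \<subseteq> V \<Longrightarrow> 0 \<le> boundary_size V w U"
  unfolding boundary_size_def
  by (intro sum_nonneg infsum_nonneg) (auto intro: weight_nonneg)

lemma edge_weight_le_vol:
  assumes "U \<subseteq> V" "U' \<subseteq> V" "finite U'"
  shows "edge_weight w U U' \<le> vol V w U"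
  unfolding edge_weight_def vol_def vertex_weight_def
  using assms by (intro sum_mono weight_sum(2)) auto

lemma edge_weight_commute:
  assumes "U \<subseteq> V" "U' \<subseteq> V"
  shows "edge_weight w U U' = edge_weight w U' U"
  unfolding edge_weight_def
  by (subst sum.swap) (intro sum.cong refl weight_sym; use assms in auto)

lemma cheeger_tendsto:
  assumes "exhaustion V \<Omega>"
  shows "(\<lambda>n. cheeger V w (\<Omega> n)) \<longlonglongrightarrow> cheeger V w V"
  unfolding cheeger_def
proof (rule tendsto_Inf_subsets)
  obtain x where "x \<in> V" using infinite by fastforce
  then have "{x} \<noteq> {} \<and> {x} \<subseteq> V \<and> finite {x}" by simp
  then show "{boundary_size V w U / vol V w U |U. U \<noteq> {} \<and> U \<subseteq> V \<and> finite U} \<noteq> {}"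
    by blast
  show "bdd_below {boundary_size V w U / vol V w U |U. U \<noteq> {} \<and> U \<subseteq> V \<and> finite U}"
    by (rule bdd_belowI[of _ 0]) (auto simp: boundary_size_nonneg vol_nonneg)
  show "{boundary_size V w U / vol V w U |U. U \<noteq> {} \<and> U \<subseteq> \<Omega> n \<and> finite U}
    \<subseteq> {boundary_size V w U / vol V w U |U. U \<noteq> {} \<and> U \<subseteq> V \<and> finite U}" for n
    using assms unfolding exhaustion_def by blast
next
  fix a assume "a \<in> {boundary_size V w U / vol V w U |U. U \<noteq> {} \<and> U \<subseteq> V \<and> finite U}"
  then obtain U where U: "a = boundary_size V w U / vol V w U" "U \<noteq> {}" "U \<subseteq> V" "finite U"
    by blast
  show "\<forall>\<^sub>F n in sequentially.
      a \<in> {boundary_size V w U / vol V w U |U. U \<noteq> {} \<and> U \<subseteq> \<Omega> n \<and> finite U}"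
    using finite_subset_exhaustion[OF assms U(4,3)] by eventually_elim (use U in blast)
qed

lemma dual_cheeger_tendsto:
  assumes "exhaustion V \<Omega>"
  shows "(\<lambda>n. dual_cheeger V w (\<Omega> n)) \<longlonglongrightarrow> dual_cheeger V w V"
  unfolding dual_cheeger_def
proof (rule tendsto_Sup_subsets, goal_cases)
  case 1
  obtain x where x: "x \<in> V" using infinite by fastforce
  have "infinite (V - {x})" using infinite by simp
  then have "V - {x} \<noteq> {}" by (metis finite.emptyI)
  then obtain y where "y \<in> V - {x}" by blast
  with x have "{x} \<noteq> {} \<and> {y} \<noteq> {} \<and> {x} \<inter> {y} = {} \<and> {x} \<subseteq> V \<and> {y} \<subseteq> V \<and> finite {x} \<and> finite {y}"
    by simp
  then show ?case by blast
next
  case 2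
  have "2 * edge_weight w A B / (vol V w A + vol V w B) \<le> 1"
    if "A \<subseteq> V" "B \<subseteq> V" "finite A" "finite B" for A B
    using edge_weight_le_vol[of A B] edge_weight_le_vol[of B A] edge_weight_commute[of A B]
      vol_nonneg[of A] vol_nonneg[of B] that
    by (auto simp: divide_le_eq_1 order_le_less)
  then show ?case by (intro bdd_aboveI[of _ 1]) blast
next
  case (3 n)
  then show ?case using assms unfolding exhaustion_def by blast
next
  case (4 a)
  then obtain A B where U: "a = 2 * edge_weight w A B / (vol V w A + vol V w B)"
    "A \<noteq> {}" "B \<noteq> {}" "A \<inter> B = {}" "A \<subseteq> V" "B \<subseteq> V" "finite A" "finite B" by blast
  show ?case
    using finite_subset_exhaustion[OF assms U(7,5)] finite_subset_exhaustion[OF assms U(8,6)]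
    by eventually_elim (use U in blast)
qed

lemma exhaustion_lim_eqI:
  assumes "\<And>\<Omega>. exhaustion V \<Omega> \<Longrightarrow> (\<lambda>n. F (\<Omega> n)) \<longlonglongrightarrow> l"
  shows "exhaustion_lim V F = l"
  unfolding exhaustion_lim_def
  using assms exhaustion_exists by (intro the_equality) (auto intro: LIMSEQ_unique)

lemma cheeger_graph_eq: "cheeger_graph V w = cheeger V w V"
  unfolding cheeger_graph_def by (intro exhaustion_lim_eqI cheeger_tendsto)

lemma dual_cheeger_graph_eq: "dual_cheeger_graph V w = dual_cheeger V w V"
  unfolding dual_cheeger_graph_def by (intro exhaustion_lim_eqI dual_cheeger_tendsto)

lemma cheeger_graph_limit:
  "exhaustion V \<Omega> \<Longrightarrow> (\<lambda>n. cheeger V w (\<Omega> n)) \<longlonglongrightarrow> cheeger_graph V w"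
  by (simp add: cheeger_graph_eq cheeger_tendsto)

lemma dual_cheeger_graph_limit:
  "exhaustion V \<Omega> \<Longrightarrow> (\<lambda>n. dual_cheeger V w (\<Omega> n)) \<longlonglongrightarrow> dual_cheeger_graph V w"
  by (simp add: dual_cheeger_graph_eq dual_cheeger_tendsto)

end

end

theory Submission
  imports Defs
begin

text \<open>
  The top of the spectrum of the self-adjoint operator \<open>\<Delta>\<close> is the supremum \<open>M\<close> of its Rayleigh
  quotients \<open>ip (\<Delta> f) f / ip f f\<close>, so both bounds are statements about quadratic forms.

  This variational principle has two halves. The form of \<open>\<Delta>\<close> lies between \<open>0\<close> and \<open>2\<close>. If it is
  at most \<open>B < l\<close>, then \<open>\<Delta>\<close> has norm at most \<open>B\<close>, the Neumann series of \<open>(l - \<Delta>)\<^sup>-\<^sup>1\<close> converges at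
  every vertex, and local finiteness lets the telescoping identity pass to the pointwise limit
  (\<open>quadratic_bound_not_in_spectrum\<close>). Conversely \<open>M - \<Delta>\<close> has no bounded inverse, because
  \<open>(M - \<Delta>) f\<close> has small norm when the Rayleigh quotient of \<open>f\<close> is close to \<open>M\<close>
  (\<open>Sup_rayleigh_in_spectrum\<close>).

  For the lower bound, the function that is \<open>1\<close> on one finite set and \<open>-1\<close> on a disjoint one
  has Rayleigh quotient at least twice the dual Cheeger ratio of the pair plus the Cheeger constant
  (\<open>cheeger_constants_le_top_of_spectrum\<close>).

  The upper bound is a Cheeger-type inequality. On a finite set, a large Rayleigh quotient forces
  \<open>f\<close> to change sign with nearly equal absolute values along most edges. Cutting \<open>f\<^sup>2\<close> into level
  sets, each split according to the sign of \<open>f\<close>, produces pairs of disjoint sets, and the dual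
  Cheeger constant limits the edge weight within each pair (\<open>dual_cheeger_level_sets\<close>).
  Cauchy-Schwarz over the edges with a sign change turns this into the square-root bound
  (\<open>dual_cheeger_finite_inequality\<close>), which passes to square-summable functions along an
  exhaustion of the graph.
\<close>

lemma summable_on_real_comparison:
  fixes f g :: "'b \<Rightarrow> real"
  assumes "g summable_on A" "\<And>x. x \<in> A \<Longrightarrow> norm (f x) \<le> g x"
  shows "f summable_on A"
  using Infinite_Sum.abs_summable_on_comparison_test'[of g A f] assms Infinite_Sum.abs_summable_summable
  by blast

lemma abs_mult_le_squares: "\<bar>a * b\<bar> \<le> (a\<^sup>2 + b\<^sup>2) / (2::real)"
proof -
  have "0 \<le> (\<bar>a\<bar> - \<bar>b\<bar>)\<^sup>2" by simp
  then show ?thesis by (simp add: power2_eq_square algebra_simps abs_mult)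
qed

lemma has_sum_exhaustion:
  assumes "(f has_sum s) A" "\<And>n. finite (F n)" "\<And>n. F n \<subseteq> A"
    "\<And>X. finite X \<Longrightarrow> X \<subseteq> A \<Longrightarrow> \<forall>\<^sub>F n in sequentially. X \<subseteq> F n"
  shows "(\<lambda>n. sum f (F n)) \<longlonglongrightarrow> s"
proof -
  have "filterlim F (finite_subsets_at_top A) sequentially"
    unfolding filterlim_finite_subsets_at_top using assms(2-4) by simp
  then show ?thesis using assms(1) unfolding has_sum_def by (rule filterlim_compose[rotated])
qed

context infinite_weighted_graph
begin

section \<open>The weighted space of square-summable functions\<close>

abbreviation "\<mu> \<equiv> vertex_weight V w"
abbreviation "L2 \<equiv> l2_space V w"
abbreviation "ip \<equiv> l2_inner V w"
abbreviation "\<Delta> \<equiv> laplacian V w"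

lemma vertex_weight_has_sum: "x \<in> V \<Longrightarrow> (w x has_sum \<mu> x) V"
  unfolding vertex_weight_def by (intro has_sum_infsum weight_sum) auto

text \<open>
  A vertex with no neighbour but itself could reach nothing else, while \<open>V\<close> is infinite and
  connected. Hence no division by a vertex weight, or by the volume of a nonempty finite set, is a
  division by zero.
\<close>

lemma vertex_weight_pos:
  assumes x: "x \<in> V"
  shows "0 < \<mu> x"
proof -
  have "infinite (V - {x})" using infinite by simp
  then obtain y where y: "y \<in> V" "y \<noteq> x" by (metis finite.emptyI equals0I Diff_iff insertCI)
  obtain z where z: "(x, z) \<in> E"
    using connected[OF x y(1)] y(2) by (metis converse_rtranclE)
  then have "z \<in> V" "0 < w x z" using edges weight_pos_iff[of x z] x by auto
  moreover have "sum (w x) {z} \<le> infsum (w x) V"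
    using weight_sum(2)[OF x order_refl, of "{z}"] \<open>z \<in> V\<close> by simp
  ultimately show ?thesis by (simp add: vertex_weight_def)
qed

lemma vol_pos: "U \<subseteq> V \<Longrightarrow> finite U \<Longrightarrow> U \<noteq> {} \<Longrightarrow> 0 < vol V w U"
  unfolding vol_def by (intro sum_pos) (auto intro: vertex_weight_pos)

lemma l2_sq_summable: "f \<in> L2 \<Longrightarrow> (\<lambda>x. \<mu> x * (f x)\<^sup>2) summable_on V"
  by (simp add: l2_space_def)

lemma l2_inner_summable:
  assumes "f \<in> L2" "g \<in> L2"
  shows "(\<lambda>x. \<mu> x * f x * g x) summable_on V"
proof -
  have "(\<lambda>x. \<mu> x * (f x)\<^sup>2 + \<mu> x * (g x)\<^sup>2) summable_on V"
    using assms by (intro summable_on_add l2_sq_summable)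
  moreover have "norm (\<mu> x * f x * g x) \<le> \<mu> x * (f x)\<^sup>2 + \<mu> x * (g x)\<^sup>2" if "x \<in> V" for x
  proof -
    have "norm (\<mu> x * f x * g x) = \<mu> x * \<bar>f x * g x\<bar>"
      using vertex_weight_pos[OF that] by (simp add: abs_mult)
    also have "\<dots> \<le> \<mu> x * ((f x)\<^sup>2 + (g x)\<^sup>2)"
      using vertex_weight_pos[OF that] abs_mult_le_squares[of "f x" "g x"]
      by (intro mult_left_mono) (auto simp: field_simps)
    finally show ?thesis by (simp add: algebra_simps)
  qed
  ultimately show ?thesis
    by (rule summable_on_real_comparison)
qed

lemma l2_inner_commute: "ip f g = ip g f"
  by (simp add: l2_inner_def mult.assoc mult.commute[of "f _"])

lemma l2_inner_self_nonneg: "0 \<le> ip f f"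
  unfolding l2_inner_def
  by (intro infsum_nonneg) (metis less_imp_le mult.assoc mult_nonneg_nonneg vertex_weight_pos zero_le_square)

lemma l2_inner_self_eq: "ip f f = (\<Sum>\<^sub>\<infinity>x\<in>V. \<mu> x * (f x)\<^sup>2)"
  by (simp add: l2_inner_def power2_eq_square mult.assoc)

lemma l2_lincomb:
  assumes "f \<in> L2" "g \<in> L2"
  shows "(\<lambda>x. a * f x + b * g x) \<in> L2"
proof -
  have "(\<lambda>x. a\<^sup>2 * (\<mu> x * (f x)\<^sup>2) + b\<^sup>2 * (\<mu> x * (g x)\<^sup>2) + (2 * a * b) * (\<mu> x * f x * g x)) summable_on V"
    using assms by (intro summable_on_add summable_on_cmult_right l2_sq_summable l2_inner_summable)
  then have "(\<lambda>x. \<mu> x * (a * f x + b * g x)\<^sup>2) summable_on V"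
    by (simp add: power2_eq_square algebra_simps)
  then show ?thesis using assms by (simp add: l2_space_def)
qed

lemma l2_inner_lincomb_left:
  assumes "f \<in> L2" "g \<in> L2" "h \<in> L2"
  shows "ip (\<lambda>x. a * f x + b * g x) h = a * ip f h + b * ip g h"
proof -
  have "ip (\<lambda>x. a * f x + b * g x) h = (\<Sum>\<^sub>\<infinity>x\<in>V. a * (\<mu> x * f x * h x) + b * (\<mu> x * g x * h x))"
    by (simp add: l2_inner_def algebra_simps)
  also have "\<dots> = (\<Sum>\<^sub>\<infinity>x\<in>V. a * (\<mu> x * f x * h x)) + (\<Sum>\<^sub>\<infinity>x\<in>V. b * (\<mu> x * g x * h x))"
    using assms by (intro infsum_add summable_on_cmult_right l2_inner_summable)
  finally show ?thesis by (simp add: l2_inner_def infsum_cmult_right')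
qed

lemma l2_inner_lincomb_right:
  assumes "f \<in> L2" "g \<in> L2" "h \<in> L2"
  shows "ip h (\<lambda>x. a * f x + b * g x) = a * ip h f + b * ip h g"
  using l2_inner_lincomb_left[OF assms] by (simp add: l2_inner_commute)

lemma finite_support_l2:
  assumes "finite F" "F \<subseteq> V" "\<And>x. x \<notin> F \<Longrightarrow> f x = 0"
  shows "f \<in> L2" and "ip f f = (\<Sum>x\<in>F. \<mu> x * (f x)\<^sup>2)"
proof -
  have hs: "((\<lambda>x. \<mu> x * (f x)\<^sup>2) has_sum (\<Sum>x\<in>F. \<mu> x * (f x)\<^sup>2)) V"
    using assms by (intro has_sum_finite_neutralI) auto
  show "f \<in> L2" using assms hs by (auto simp: l2_space_def summable_on_def)
  show "ip f f = (\<Sum>x\<in>F. \<mu> x * (f x)\<^sup>2)"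
    unfolding l2_inner_self_eq by (rule infsumI[OF hs])
qed

section \<open>The Laplacian as a symmetric operator\<close>

text \<open>
  Summing out \<open>y\<close> first gives \<open>\<mu> x\<close>. These sums dominate all sums over pairs of vertices below.
\<close>

lemma weighted_sq_fst_has_sum:
  assumes "f \<in> L2"
  shows "((\<lambda>(x, y). w x y * (f x)\<^sup>2) has_sum ip f f) (V \<times> V)"
proof -
  have inner: "((\<lambda>y. case (x, y) of (x, y) \<Rightarrow> w x y * (f x)\<^sup>2) has_sum \<mu> x * (f x)\<^sup>2) V" if "x \<in> V" for x
    using has_sum_cmult_left[OF vertex_weight_has_sum[OF that]] by simp
  have "(\<lambda>(x, y). w x y * (f x)\<^sup>2) summable_on V \<times> V"
    using inner l2_sq_summable[OF assms]
    by (rule summable_on_SigmaI) (auto intro!: mult_nonneg_nonneg weight_nonneg)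
  with inner show ?thesis
    unfolding l2_inner_self_eq
    by (rule has_sum_SigmaI[OF _ has_sum_infsum[OF l2_sq_summable[OF assms]]])
qed

lemma weighted_sq_snd_has_sum:
  assumes "f \<in> L2"
  shows "((\<lambda>(x, y). w x y * (f y)\<^sup>2) has_sum ip f f) (V \<times> V)"
proof -
  have "((\<lambda>(x, y). w y x * (f y)\<^sup>2) has_sum ip f f) (V \<times> V)"
    using weighted_sq_fst_has_sum[OF assms] by (subst (asm) has_sum_swap) simp
  then show ?thesis
    by (rule has_sum_cong[THEN iffD1, rotated]) (auto simp: weight_sym)
qed

text \<open>
  The bilinear form of the averaging operator \<open>1 - \<Delta>\<close>. It is a single sum over \<open>V \<times> V\<close> so that
  symmetry of the weights turns into invariance under swapping the coordinates.
\<close>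

definition nbr_form :: "('a \<Rightarrow> real) \<Rightarrow> ('a \<Rightarrow> real) \<Rightarrow> real"
  where "nbr_form f g = (\<Sum>\<^sub>\<infinity>(x, y)\<in>V \<times> V. w x y * (f x * g y))"

lemma nbr_form_has_sum:
  assumes "f \<in> L2" "g \<in> L2"
  shows "((\<lambda>(x, y). w x y * (f x * g y)) has_sum nbr_form f g) (V \<times> V)"
proof -
  have "(\<lambda>p. (case p of (x, y) \<Rightarrow> w x y * (f x)\<^sup>2) + (case p of (x, y) \<Rightarrow> w x y * (g y)\<^sup>2)) summable_on V \<times> V"
    using weighted_sq_fst_has_sum[OF assms(1)] weighted_sq_snd_has_sum[OF assms(2)]
    by (intro summable_on_add) (auto simp: summable_on_def)
  moreover have "norm (case p of (x, y) \<Rightarrow> w x y * (f x * g y))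
      \<le> (case p of (x, y) \<Rightarrow> w x y * (f x)\<^sup>2) + (case p of (x, y) \<Rightarrow> w x y * (g y)\<^sup>2)"
    if "p \<in> V \<times> V" for p
  proof -
    obtain x y where p: "p = (x, y)" "x \<in> V" "y \<in> V" using \<open>p \<in> V \<times> V\<close> by auto
    have "norm (w x y * (f x * g y)) = w x y * \<bar>f x * g y\<bar>"
      using weight_nonneg[OF p(2,3)] by (simp add: abs_mult)
    also have "\<dots> \<le> w x y * ((f x)\<^sup>2 + (g y)\<^sup>2)"
      using weight_nonneg[OF p(2,3)] abs_mult_le_squares[of "f x" "g y"]
      by (intro mult_left_mono) (auto simp: field_simps)
    finally show ?thesis by (simp add: p(1) algebra_simps)
  qed
  ultimately have "(\<lambda>(x, y). w x y * (f x * g y)) summable_on V \<times> V"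
    by (rule summable_on_real_comparison)
  then show ?thesis unfolding nbr_form_def by (rule has_sum_infsum)
qed

lemma finite_support_nbr_form:
  assumes "finite F" "F \<subseteq> V" "\<And>x. x \<notin> F \<Longrightarrow> f x = 0"
  shows "nbr_form f f = (\<Sum>(x, y)\<in>F \<times> F. w x y * (f x * f y))"
  unfolding nbr_form_def
proof (rule infsumI, rule has_sum_finite_neutralI)
  show "(case p of (x, y) \<Rightarrow> w x y * (f x * f y)) = 0" if "p \<in> V \<times> V - F \<times> F" for p
  proof -
    obtain x y where p: "p = (x, y)" by (cases p)
    then have "x \<notin> F \<or> y \<notin> F" using that by blast
    then have "f x = 0 \<or> f y = 0" using assms(3) by blast
    then show ?thesis by (auto simp: p)
  qed
qed (use assms in auto)

lemma nbr_form_commute: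
  assumes "f \<in> L2" "g \<in> L2"
  shows "nbr_form f g = nbr_form g f"
proof -
  have "((\<lambda>(x, y). w y x * (f y * g x)) has_sum nbr_form f g) (V \<times> V)"
    using nbr_form_has_sum[OF assms] by (subst (asm) has_sum_swap) simp
  then have "((\<lambda>(x, y). w x y * (g x * f y)) has_sum nbr_form f g) (V \<times> V)"
    by (rule has_sum_cong[THEN iffD1, rotated]) (auto simp: weight_sym mult.commute)
  then show ?thesis using nbr_form_has_sum[OF assms(2,1)] has_sum_unique by blast
qed

text \<open>
  Pointwise \<open>\<bar>f x * f y\<bar> \<le> ((f x)\<^sup>2 + (f y)\<^sup>2) / 2\<close>. This single estimate yields both
  \<open>0 \<le> \<Delta>\<close> and \<open>\<Delta> \<le> 2\<close>.
\<close>

lemma nbr_form_abs_le: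
  assumes "f \<in> L2"
  shows "\<bar>nbr_form f f\<bar> \<le> ip f f"
proof -
  let ?s = "\<lambda>p. (1/2) * (case p of (x, y) \<Rightarrow> w x y * (f x)\<^sup>2) + (1/2) * (case p of (x, y) \<Rightarrow> w x y * (f y)\<^sup>2)"
  have s: "(?s has_sum ((1/2) * ip f f + (1/2) * ip f f)) (V \<times> V)"
    by (intro has_sum_add has_sum_cmult_right weighted_sq_fst_has_sum weighted_sq_snd_has_sum assms)
  have b: "\<bar>case p of (x, y) \<Rightarrow> w x y * (f x * f y)\<bar> \<le> ?s p" if p: "p \<in> V \<times> V" for p
  proof -
    obtain x y where p: "p = (x, y)" "x \<in> V" "y \<in> V" using p by auto
    have "\<bar>w x y * (f x * f y)\<bar> = w x y * \<bar>f x * f y\<bar>"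
      using weight_nonneg[OF p(2,3)] by (simp add: abs_mult)
    also have "\<dots> \<le> w x y * (((f x)\<^sup>2 + (f y)\<^sup>2) / 2)"
      using weight_nonneg[OF p(2,3)] abs_mult_le_squares by (intro mult_left_mono)
    finally show ?thesis by (simp add: p(1) algebra_simps)
  qed
  have nf': "((\<lambda>p. - (case p of (x, y) \<Rightarrow> w x y * (f x * f y))) has_sum - nbr_form f f) (V \<times> V)"
    using nbr_form_has_sum[OF assms assms] by (simp add: has_sum_uminus)
  have "nbr_form f f \<le> (1/2) * ip f f + (1/2) * ip f f"
    by (rule has_sum_mono[OF nbr_form_has_sum[OF assms assms] s]) (use b in \<open>meson abs_le_D1\<close>)
  moreover have "- nbr_form f f \<le> (1/2) * ip f f + (1/2) * ip f f"
    by (rule has_sum_mono[OF nf' s]) (use b in \<open>meson abs_le_D2\<close>)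
  ultimately show ?thesis by simp
qed

lemma weighted_nbrs_infsum:
  assumes "x \<in> V"
  shows "(\<Sum>\<^sub>\<infinity>y\<in>V. w x y * f y) = (\<Sum>y | (x, y) \<in> E. w x y * f y)"
proof (rule infsumI, rule has_sum_finite_neutralI)
  fix y assume "y \<in> V - {y. (x, y) \<in> E}"
  then have "w x y = 0"
    using weight_nonneg[of x y] weight_pos_iff[of x y] assms by force
  then show "w x y * f y = 0" by simp
qed (use edges locally_finite[OF assms] in auto)

text \<open>
  Local finiteness makes \<open>\<Delta> f x\<close> depend on finitely many values of \<open>f\<close>, so \<open>\<Delta>\<close> commutes with
  pointwise limits.
\<close>

lemma laplacian_eq_nbr_sum:
  "x \<in> V \<Longrightarrow> \<Delta> f x = f x - (1 / \<mu> x) * (\<Sum>y | (x, y) \<in> E. w x y * f y)"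
  by (simp add: laplacian_def weighted_nbrs_infsum)

lemma laplacian_lincomb: "\<Delta> (\<lambda>x. a * f x + b * g x) = (\<lambda>x. a * \<Delta> f x + b * \<Delta> g x)"
proof
  fix x
  show "\<Delta> (\<lambda>x. a * f x + b * g x) x = a * \<Delta> f x + b * \<Delta> g x"
  proof (cases "x \<in> V")
    case True
    have "(\<Sum>y | (x, y) \<in> E. w x y * (a * f y + b * g y)) =
        a * (\<Sum>y | (x, y) \<in> E. w x y * f y) + b * (\<Sum>y | (x, y) \<in> E. w x y * g y)"
      by (simp add: sum_distrib_left sum.distrib algebra_simps)
    with True show ?thesis by (simp add: laplacian_eq_nbr_sum algebra_simps)
  next
    case False
    then show ?thesis by (simp add: laplacian_def)
  qed
qed

text \<open>
  By Cauchy-Schwarz the neighbour average \<open>P\<close> of \<open>f\<close> satisfies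
  \<open>\<mu> x * (P x)\<^sup>2 \<le> \<Sum>y. w x y * (f y)\<^sup>2\<close>, and the right-hand side is summable over \<open>x\<close>.
\<close>

lemma laplacian_l2:
  assumes f: "f \<in> L2"
  shows "\<Delta> f \<in> L2"
proof -
  define P where "P x = (if x \<in> V then (1 / \<mu> x) * (\<Sum>y | (x, y) \<in> E. w x y * f y) else 0)" for x
  have "(\<lambda>x. \<Sum>\<^sub>\<infinity>y\<in>V. w x y * (f y)\<^sup>2) summable_on V"
    using summable_on_Sigma_banach[of "\<lambda>x y. w x y * (f y)\<^sup>2" V "\<lambda>_. V"]
      weighted_sq_snd_has_sum[OF f] by (auto simp: summable_on_def)
  then have "(\<lambda>x. \<mu> x * (P x)\<^sup>2) summable_on V"
  proof (rule summable_on_comparison_test)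
    fix x assume x: "x \<in> V"
    let ?N = "{y. (x, y) \<in> E}"
    have w0: "0 \<le> w x y" if "y \<in> ?N" for y using that edges x weight_nonneg by auto
    have "(\<Sum>y\<in>?N. w x y * f y)\<^sup>2 = (\<Sum>y\<in>?N. sqrt (w x y) * (sqrt (w x y) * f y))\<^sup>2"
      using w0 by (simp flip: mult.assoc)
    also have "\<dots> \<le> (\<Sum>y\<in>?N. (sqrt (w x y))\<^sup>2) * (\<Sum>y\<in>?N. (sqrt (w x y) * f y)\<^sup>2)"
      by (rule Cauchy_Schwarz_ineq_sum)
    also have "\<dots> = (\<Sum>y\<in>?N. w x y * 1) * (\<Sum>y\<in>?N. w x y * (f y)\<^sup>2)"
      using w0 by (simp add: power_mult_distrib)
    also have "(\<Sum>y\<in>?N. w x y * 1) = \<mu> x"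
      using weighted_nbrs_infsum[OF x, of "\<lambda>_. 1"] by (simp add: vertex_weight_def)
    also have "(\<Sum>y\<in>?N. w x y * (f y)\<^sup>2) = (\<Sum>\<^sub>\<infinity>y\<in>V. w x y * (f y)\<^sup>2)"
      using weighted_nbrs_infsum[OF x] by simp
    finally show "\<mu> x * (P x)\<^sup>2 \<le> (\<Sum>\<^sub>\<infinity>y\<in>V. w x y * (f y)\<^sup>2)"
      using x vertex_weight_pos[OF x] by (simp add: P_def power2_eq_square field_simps)
    show "0 \<le> \<mu> x * (P x)\<^sup>2" using vertex_weight_pos[OF x] by simp
  qed
  then have "P \<in> L2" by (simp add: l2_space_def P_def)
  from l2_lincomb[OF f this, of 1 "-1"] have "(\<lambda>x. f x - P x) \<in> L2" by simp
  moreover have "\<Delta> f = (\<lambda>x. f x - P x)"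
  proof
    fix x
    show "\<Delta> f x = f x - P x"
      using f laplacian_eq_nbr_sum[of x f] by (cases "x \<in> V") (auto simp: P_def l2_space_def laplacian_def)
  qed
  ultimately show ?thesis by simp
qed

lemma laplacian_inner:
  assumes "f \<in> L2" "g \<in> L2"
  shows "ip (\<Delta> f) g = ip f g - nbr_form f g"
proof -
  note hs = nbr_form_has_sum[OF assms(2,1)]
  have nf: "nbr_form g f = (\<Sum>\<^sub>\<infinity>x\<in>V. \<Sum>\<^sub>\<infinity>y\<in>V. w x y * (g x * f y))"
    unfolding nbr_form_def using hs
    by (subst infsum_Sigma'_banach) (auto simp: summable_on_def)
  have sm: "(\<lambda>x. \<Sum>\<^sub>\<infinity>y\<in>V. w x y * (g x * f y)) summable_on V"
    using hs by (intro summable_on_Sigma_banach) (auto simp: summable_on_def)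
  have "ip (\<Delta> f) g = (\<Sum>\<^sub>\<infinity>x\<in>V. \<mu> x * f x * g x - (\<Sum>\<^sub>\<infinity>y\<in>V. w x y * (g x * f y)))"
    unfolding l2_inner_def
  proof (rule infsum_cong)
    fix x assume x: "x \<in> V"
    have "(\<Sum>\<^sub>\<infinity>y\<in>V. w x y * (g x * f y)) = g x * (\<Sum>\<^sub>\<infinity>y\<in>V. w x y * f y)"
      by (subst infsum_cmult_right'[symmetric]) (simp add: ac_simps)
    then show "\<mu> x * \<Delta> f x * g x = \<mu> x * f x * g x - (\<Sum>\<^sub>\<infinity>y\<in>V. w x y * (g x * f y))"
      using x vertex_weight_pos[OF x] by (simp add: laplacian_def field_simps)
  qed
  also have "\<dots> = ip f g - nbr_form g f"
    unfolding l2_inner_def nf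
    using infsum_add[OF l2_inner_summable[OF assms] summable_on_uminus[THEN iffD2, OF sm]]
    by (simp add: infsum_uminus)
  finally show ?thesis using nbr_form_commute[OF assms] by simp
qed

lemma laplacian_symmetric: "f \<in> L2 \<Longrightarrow> g \<in> L2 \<Longrightarrow> ip (\<Delta> f) g = ip f (\<Delta> g)"
  by (metis laplacian_inner l2_inner_commute nbr_form_commute)

lemma laplacian_quadratic_bounds:
  assumes "f \<in> L2"
  shows "0 \<le> ip (\<Delta> f) f" and "ip (\<Delta> f) f \<le> 2 * ip f f"
  using nbr_form_abs_le[OF assms] by (auto simp: laplacian_inner assms abs_le_iff)

lemma l2_inner_lincomb_both:
  assumes "f \<in> L2" "g \<in> L2" "h \<in> L2" "k \<in> L2"
  shows "ip (\<lambda>x. a * f x + b * g x) (\<lambda>x. c * h x + d * k x) =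
    a * c * ip f h + a * d * ip f k + b * c * ip g h + b * d * ip g k"
  unfolding l2_inner_lincomb_left[OF assms(1,2) l2_lincomb[OF assms(3,4)]]
    l2_inner_lincomb_right[OF assms(3,4,1)] l2_inner_lincomb_right[OF assms(3,4,2)]
  by (simp add: algebra_simps)

lemma l2_pointwise_le:
  assumes "f \<in> L2" "x \<in> V"
  shows "\<mu> x * (f x)\<^sup>2 \<le> ip f f"
proof -
  have "sum (\<lambda>x. \<mu> x * (f x)\<^sup>2) {x} \<le> (\<Sum>\<^sub>\<infinity>x\<in>V. \<mu> x * (f x)\<^sup>2)"
    using assms less_imp_le[OF vertex_weight_pos]
    by (intro finite_sum_le_infsum l2_sq_summable) auto
  then show ?thesis by (simp add: l2_inner_self_eq)
qed

lemma l2_inner_self_zeroD: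
  assumes "f \<in> L2" "ip f f = 0"
  shows "f = (\<lambda>_. 0)"
proof
  fix x
  show "f x = 0"
  proof (cases "x \<in> V")
    case True
    with l2_pointwise_le[OF assms(1) True] vertex_weight_pos[OF True] assms(2) show ?thesis
      by (simp add: mult_le_0_iff)
  qed (use assms in \<open>simp add: l2_space_def\<close>)
qed

section \<open>The top of the spectrum as the largest Rayleigh quotient\<close>

text \<open>
  Nonnegativity of \<open>A\<close> at \<open>f - t * A f\<close> with the step \<open>t = 1 / K\<close>. The lemma replaces the
  operator norm of a self-adjoint operator: for \<open>A = \<Delta>\<close> it bounds \<open>\<Delta>\<close> by its largest Rayleigh
  quotient, and for \<open>A = M - \<Delta>\<close> it shows that \<open>A f\<close> is small whenever \<open>f\<close> is nearly optimal.
\<close>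

lemma nonneg_operator_inner_sq_le:
  assumes A: "\<And>f. f \<in> L2 \<Longrightarrow> A f \<in> L2"
    and lin: "\<And>f g a b. f \<in> L2 \<Longrightarrow> g \<in> L2 \<Longrightarrow>
      A (\<lambda>x. a * f x + b * g x) = (\<lambda>x. a * A f x + b * A g x)"
    and sym: "\<And>f g. f \<in> L2 \<Longrightarrow> g \<in> L2 \<Longrightarrow> ip (A f) g = ip f (A g)"
    and nonneg: "\<And>f. f \<in> L2 \<Longrightarrow> 0 \<le> ip (A f) f"
    and upper: "\<And>f. f \<in> L2 \<Longrightarrow> ip (A f) f \<le> K * ip f f"
    and "0 < K" "f \<in> L2"
  shows "ip (A f) (A f) \<le> K * ip (A f) f"
proof -
  note f = \<open>f \<in> L2\<close> and Af = A[OF \<open>f \<in> L2\<close>]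
  let ?h = "\<lambda>x. 1 * f x + (- (1 / K)) * A f x"
  have "0 \<le> ip (A ?h) ?h" using l2_lincomb[OF f Af] by (rule nonneg)
  also have "A ?h = (\<lambda>x. 1 * A f x + (- (1 / K)) * A (A f) x)"
    by (rule lin[OF f Af])
  also have "ip \<dots> ?h = ip (A f) f - 2 / K * ip (A f) (A f) + (1 / K)\<^sup>2 * ip (A (A f)) (A f)"
    unfolding l2_inner_lincomb_both[OF Af A[OF Af] f Af] sym[OF Af f]
    by (simp add: power2_eq_square)
  also have "\<dots> \<le> ip (A f) f - 2 / K * ip (A f) (A f) + (1 / K)\<^sup>2 * (K * ip (A f) (A f))"
    by (intro add_left_mono mult_left_mono upper Af) simp
  also have "\<dots> = ip (A f) f - ip (A f) (A f) / K"
    using \<open>0 < K\<close> by (simp add: power2_eq_square field_simps)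
  finally show ?thesis using \<open>0 < K\<close> by (simp add: field_simps)
qed

text \<open>
  Partial sums of the expansion \<open>(l - \<Delta>)\<^sup>-\<^sup>1 = \<Sum>n. \<Delta>\<^sup>n / l\<^sup>n\<^sup>+\<^sup>1\<close>, taken pointwise.
\<close>

definition neumann_sum :: "real \<Rightarrow> nat \<Rightarrow> ('a \<Rightarrow> real) \<Rightarrow> 'a \<Rightarrow> real"
  where "neumann_sum l k f x = (\<Sum>n<k. (\<Delta> ^^ n) f x / l ^ Suc n)"

lemma laplacian_iterate_l2: "f \<in> L2 \<Longrightarrow> (\<Delta> ^^ n) f \<in> L2"
  by (induction n) (auto intro: laplacian_l2)

lemma neumann_sum_Suc: "neumann_sum l (Suc k) f = (\<lambda>x. 1 * neumann_sum l k f x + (1 / l ^ Suc k) * (\<Delta> ^^ k) f x)"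
  by (auto simp: neumann_sum_def)

lemma neumann_sum_l2: "f \<in> L2 \<Longrightarrow> neumann_sum l k f \<in> L2"
proof (induction k)
  case 0
  show ?case by (simp add: neumann_sum_def l2_space_def)
next
  case (Suc k)
  then show ?case unfolding neumann_sum_Suc by (intro l2_lincomb laplacian_iterate_l2)
qed

lemma neumann_sum_telescope:
  assumes "l \<noteq> 0"
  shows "l * neumann_sum l k f x - \<Delta> (neumann_sum l k f) x = f x - (\<Delta> ^^ k) f x / l ^ k"
proof (induction k)
  case 0
  show ?case by (simp add: neumann_sum_def laplacian_def)
next
  case (Suc k)
  then show ?case
    unfolding neumann_sum_Suc laplacian_lincomb using assms by (simp add: field_simps)
qed

definition neumann_series :: "real \<Rightarrow> ('a \<Rightarrow> real) \<Rightarrow> 'a \<Rightarrow> real"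
  where "neumann_series l f x = (\<Sum>n. (\<Delta> ^^ n) f x / l ^ Suc n)"

context
  fixes B l :: real
  assumes B: "\<And>f. f \<in> L2 \<Longrightarrow> ip (\<Delta> f) f \<le> B * ip f f" and B_pos: "0 < B" and B_less: "B < l"
begin

text \<open>
  \<open>l - \<Delta> \<ge> l - B\<close> as a quadratic form, so \<open>l - \<Delta>\<close> expands norms by at least \<open>l - B\<close>. This
  gives injectivity of \<open>l - \<Delta>\<close>, hence linearity of its right inverse, and the norm bounds on it.
\<close>

lemma shifted_laplacian_coercive:
  assumes g: "g \<in> L2"
  shows "(l - B)\<^sup>2 * ip g g \<le> ip (\<lambda>x. l * g x - \<Delta> g x) (\<lambda>x. l * g x - \<Delta> g x)"
proof -
  let ?h = "\<lambda>x. l * g x - \<Delta> g x"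
  have h: "?h \<in> L2" using l2_lincomb[OF g laplacian_l2[OF g], of l "-1"] by simp
  have "ip ?h g = l * ip g g - ip (\<Delta> g) g"
    using l2_inner_lincomb_left[OF g laplacian_l2[OF g] g, of l "-1"] by simp
  then have c: "(l - B) * ip g g \<le> ip ?h g" using B[OF g] by (simp add: algebra_simps)
  have "0 \<le> ip ?h ?h - 2 * (l - B) * ip ?h g + (l - B)\<^sup>2 * ip g g"
    using l2_inner_self_nonneg[of "\<lambda>x. 1 * ?h x + (- (l - B)) * g x"]
    unfolding l2_inner_lincomb_both[OF h g h g] l2_inner_commute[of g ?h]
    by (simp add: power2_eq_square algebra_simps)
  moreover have "2 * (l - B) * ((l - B) * ip g g) \<le> 2 * (l - B) * ip ?h g"
    using c B_less by (intro mult_left_mono) auto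
  ultimately show ?thesis by (simp add: power2_eq_square algebra_simps)
qed

lemma laplacian_inner_self_le:
  assumes f: "f \<in> L2"
  shows "ip (\<Delta> f) (\<Delta> f) \<le> B\<^sup>2 * ip f f"
proof -
  have "ip (\<Delta> f) (\<Delta> f) \<le> B * ip (\<Delta> f) f"
    using laplacian_l2 laplacian_lincomb laplacian_symmetric laplacian_quadratic_bounds(1) B B_pos f
    by (rule nonneg_operator_inner_sq_le)
  also have "\<dots> \<le> B * (B * ip f f)" using B[OF f] B_pos by (intro mult_left_mono) auto
  finally show ?thesis by (simp add: power2_eq_square)
qed

lemma laplacian_iterate_inner_self_le:
  assumes f: "f \<in> L2"
  shows "ip ((\<Delta> ^^ n) f) ((\<Delta> ^^ n) f) \<le> (B ^ n)\<^sup>2 * ip f f"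
proof (induction n)
  case (Suc n)
  have "ip ((\<Delta> ^^ Suc n) f) ((\<Delta> ^^ Suc n) f) \<le> B\<^sup>2 * ip ((\<Delta> ^^ n) f) ((\<Delta> ^^ n) f)"
    using laplacian_inner_self_le[OF laplacian_iterate_l2[OF f, of n]] by simp
  also have "\<dots> \<le> B\<^sup>2 * ((B ^ n)\<^sup>2 * ip f f)" using Suc by (intro mult_left_mono) auto
  finally show ?case by (simp add: power_mult_distrib)
qed simp

text \<open>
  A value \<open>f x\<close> is controlled by the norm of \<open>f\<close>, so the Neumann series converges geometrically
  at every vertex.
\<close>

lemma neumann_terms_bound:
  assumes f: "f \<in> L2" and x: "x \<in> V"
  shows "\<bar>(\<Delta> ^^ n) f x / l ^ n\<bar> \<le> sqrt (ip f f / \<mu> x) * (B / l) ^ n"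
proof -
  have "\<mu> x * ((\<Delta> ^^ n) f x)\<^sup>2 \<le> (B ^ n)\<^sup>2 * ip f f"
    using l2_pointwise_le[OF laplacian_iterate_l2[OF f] x] laplacian_iterate_inner_self_le[OF f]
    by (rule order_trans)
  then have "((\<Delta> ^^ n) f x)\<^sup>2 \<le> (B ^ n)\<^sup>2 * (ip f f / \<mu> x)"
    using vertex_weight_pos[OF x] by (simp add: field_simps)
  then have "\<bar>(\<Delta> ^^ n) f x\<bar> \<le> sqrt ((B ^ n)\<^sup>2 * (ip f f / \<mu> x))"
    using real_le_rsqrt[of "\<bar>(\<Delta> ^^ n) f x\<bar>"] by simp
  also have "\<dots> = B ^ n * sqrt (ip f f / \<mu> x)"
    using B_pos by (simp only: real_sqrt_mult) simp
  finally have "\<bar>(\<Delta> ^^ n) f x\<bar> / l ^ n \<le> B ^ n * sqrt (ip f f / \<mu> x) / l ^ n"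
    using B_pos B_less by (intro divide_right_mono) auto
  then show ?thesis using B_pos B_less by (simp add: power_divide abs_mult mult.commute)
qed

lemma neumann_sum_tendsto:
  assumes f: "f \<in> L2"
  shows "(\<lambda>k. neumann_sum l k f x) \<longlonglongrightarrow> neumann_series l f x"
proof (cases "x \<in> V")
  case True
  have "summable (\<lambda>n. sqrt (ip f f / \<mu> x) * (B / l) ^ n / l)"
    using B_pos B_less by (intro summable_divide summable_mult summable_geometric) simp
  moreover have "norm ((\<Delta> ^^ n) f x / l ^ Suc n) \<le> sqrt (ip f f / \<mu> x) * (B / l) ^ n / l" for n
  proof -
    have "norm ((\<Delta> ^^ n) f x / l ^ Suc n) = \<bar>(\<Delta> ^^ n) f x / l ^ n\<bar> / l"
      using B_pos B_less by (simp add: abs_mult field_simps)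
    also have "\<dots> \<le> sqrt (ip f f / \<mu> x) * (B / l) ^ n / l"
      using neumann_terms_bound[OF f True] B_pos B_less by (intro divide_right_mono) auto
    finally show ?thesis .
  qed
  ultimately have "summable (\<lambda>n. (\<Delta> ^^ n) f x / l ^ Suc n)"
    by (rule summable_comparison_test'[where N = 0])
  then show ?thesis unfolding neumann_sum_def neumann_series_def by (rule summable_LIMSEQ)
next
  case False
  then have "(\<Delta> ^^ n) f x = 0" for n
    using laplacian_iterate_l2[OF f] by (simp add: l2_space_def)
  then show ?thesis by (simp add: neumann_sum_def neumann_series_def)
qed

text \<open>
  The telescoping identity for the partial sums passes to the limit because the Laplacian at \<open>x\<close>
  is a finite sum.
\<close>

lemma laplacian_neumann_series:
  assumes f: "f \<in> L2"
  shows "l * neumann_series l f x - \<Delta> (neumann_series l f) x = f x"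
proof (cases "x \<in> V")
  case True
  have "(\<lambda>k. l * neumann_sum l k f x - \<Delta> (neumann_sum l k f) x) \<longlonglongrightarrow>
      l * neumann_series l f x - \<Delta> (neumann_series l f) x"
    unfolding laplacian_eq_nbr_sum[OF True]
    by (intro tendsto_intros neumann_sum_tendsto f)
  moreover have "(\<lambda>k. f x - (\<Delta> ^^ k) f x / l ^ k) \<longlonglongrightarrow> f x - 0"
  proof (intro tendsto_diff tendsto_const)
    have "(\<lambda>k. sqrt (ip f f / \<mu> x) * (B / l) ^ k) \<longlonglongrightarrow> sqrt (ip f f / \<mu> x) * 0"
      using B_pos B_less by (intro tendsto_mult tendsto_const LIMSEQ_realpow_zero) auto
    then have null: "(\<lambda>k. sqrt (ip f f / \<mu> x) * (B / l) ^ k) \<longlonglongrightarrow> 0" by (simp only: mult_zero_right)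
    have bound: "norm ((\<Delta> ^^ k) f x / l ^ k) \<le> sqrt (ip f f / \<mu> x) * (B / l) ^ k" for k
      unfolding real_norm_def by (rule neumann_terms_bound[OF f True])
    show "(\<lambda>k. (\<Delta> ^^ k) f x / l ^ k) \<longlonglongrightarrow> 0"
      by (rule Lim_null_comparison[OF always_eventually[OF allI[OF bound]] null])
  qed
  moreover have "l * neumann_sum l k f x - \<Delta> (neumann_sum l k f) x = f x - (\<Delta> ^^ k) f x / l ^ k" for k
    using B_pos B_less by (intro neumann_sum_telescope) simp
  ultimately show ?thesis by (simp add: LIMSEQ_unique)
next
  case False
  then have "(\<Delta> ^^ n) f x = 0" for n
    using laplacian_iterate_l2[OF f] by (simp add: l2_space_def)
  from this[of 0] this show ?thesis using False by (simp add: neumann_series_def laplacian_def)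
qed

text \<open>
  By telescoping, \<open>l - \<Delta>\<close> maps the partial sum to \<open>f - \<Delta>\<^sup>k f / l\<^sup>k\<close>, whose squared norm is at
  most \<open>4 * ip f f\<close>; coercivity then bounds the partial sum, uniformly in \<open>k\<close>.
\<close>

lemma neumann_sum_inner_self_le:
  assumes f: "f \<in> L2"
  shows "(l - B)\<^sup>2 * ip (neumann_sum l k f) (neumann_sum l k f) \<le> 4 * ip f f"
proof -
  let ?g = "(\<Delta> ^^ k) f"
  have g: "?g \<in> L2" by (rule laplacian_iterate_l2[OF f])
  have "B ^ k \<le> l ^ k" using B_pos B_less by (intro power_mono) auto
  then have q: "(B ^ k)\<^sup>2 \<le> (l ^ k)\<^sup>2" using B_pos B_less by (intro power_mono) auto
  have "(1 / l ^ k)\<^sup>2 * ip ?g ?g \<le> (1 / l ^ k)\<^sup>2 * ((B ^ k)\<^sup>2 * ip f f)"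
    by (intro mult_left_mono laplacian_iterate_inner_self_le f) auto
  also have "\<dots> = ((B ^ k)\<^sup>2 / (l ^ k)\<^sup>2) * ip f f" by (simp add: power_divide)
  also have "\<dots> \<le> 1 * ip f f"
    using q B_pos B_less by (intro mult_right_mono l2_inner_self_nonneg) (simp add: divide_le_eq_1)
  finally have small: "(1 / l ^ k)\<^sup>2 * ip ?g ?g \<le> ip f f" by simp
  have "(l - B)\<^sup>2 * ip (neumann_sum l k f) (neumann_sum l k f) \<le>
      ip (\<lambda>x. 1 * f x + (- (1 / l ^ k)) * ?g x) (\<lambda>x. 1 * f x + (- (1 / l ^ k)) * ?g x)"
    using shifted_laplacian_coercive[OF neumann_sum_l2[OF f, of l k]] B_pos B_less
    by (simp add: neumann_sum_telescope)
  also have "\<dots> \<le> 2 * ip f f + 2 * ((1 / l ^ k)\<^sup>2 * ip ?g ?g)"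
    using l2_inner_self_nonneg[of "\<lambda>x. 1 * f x + (1 / l ^ k) * ?g x"]
    unfolding l2_inner_lincomb_both[OF f g f g] by (simp add: power2_eq_square)
  finally show ?thesis using small by linarith
qed

text \<open>
  Fatou's lemma for sums: the uniform bound on the partial sums survives in the pointwise limit on
  every finite set of vertices.
\<close>

lemma neumann_series_l2:
  assumes f: "f \<in> L2"
  shows "neumann_series l f \<in> L2"
proof -
  let ?g = "neumann_series l f"
  have "(\<lambda>x. \<mu> x * (?g x)\<^sup>2) summable_on V"
  proof (rule nonneg_bdd_above_summable_on)
    show "bdd_above (sum (\<lambda>x. \<mu> x * (?g x)\<^sup>2) ` {F. F \<subseteq> V \<and> finite F})"
    proof (rule bdd_aboveI2)
      fix F assume F: "F \<in> {F. F \<subseteq> V \<and> finite F}"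
      have "(\<lambda>k. \<Sum>x\<in>F. \<mu> x * (neumann_sum l k f x)\<^sup>2) \<longlonglongrightarrow> (\<Sum>x\<in>F. \<mu> x * (?g x)\<^sup>2)"
        by (intro tendsto_intros neumann_sum_tendsto f)
      moreover have "(\<Sum>x\<in>F. \<mu> x * (neumann_sum l k f x)\<^sup>2) \<le> 4 * ip f f / (l - B)\<^sup>2" for k
      proof -
        have "(\<Sum>x\<in>F. \<mu> x * (neumann_sum l k f x)\<^sup>2) \<le> ip (neumann_sum l k f) (neumann_sum l k f)"
          unfolding l2_inner_self_eq using F less_imp_le[OF vertex_weight_pos]
          by (intro finite_sum_le_infsum l2_sq_summable neumann_sum_l2 f) auto
        also have "\<dots> \<le> 4 * ip f f / (l - B)\<^sup>2"
          using neumann_sum_inner_self_le[OF f] B_less by (simp add: field_simps)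
        finally show ?thesis .
      qed
      ultimately show "(\<Sum>x\<in>F. \<mu> x * (?g x)\<^sup>2) \<le> 4 * ip f f / (l - B)\<^sup>2"
        by (intro LIMSEQ_le_const2) auto
    qed
  qed (use less_imp_le[OF vertex_weight_pos] in auto)
  moreover have "?g x = 0" if "x \<notin> V" for x
  proof -
    have "(\<Delta> ^^ n) f x = 0" for n
      using laplacian_iterate_l2[OF f] that by (simp add: l2_space_def)
    then show ?thesis by (simp add: neumann_series_def)
  qed
  ultimately show ?thesis by (simp add: l2_space_def)
qed

lemma shifted_laplacian_inj:
  assumes "f \<in> L2" "g \<in> L2" "\<And>x. l * f x - \<Delta> f x = l * g x - \<Delta> g x"
  shows "f = g"
proof -
  let ?h = "\<lambda>x. 1 * f x + (-1) * g x"
  have h: "?h \<in> L2" using assms by (intro l2_lincomb)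
  have "l * ?h x - \<Delta> ?h x = 0" for x
    using assms(3)[of x] unfolding laplacian_lincomb by (simp add: algebra_simps)
  then have "(l - B)\<^sup>2 * ip ?h ?h \<le> ip (\<lambda>_. 0) (\<lambda>_. 0)"
    using shifted_laplacian_coercive[OF h] by simp
  then have "ip ?h ?h = 0"
    using B_less l2_inner_self_nonneg[of ?h] by (simp add: l2_inner_def mult_le_0_iff)
  from l2_inner_self_zeroD[OF h this] have "?h x = 0" for x by meson
  then show ?thesis by auto
qed

text \<open>
  The resolvent is \<open>f \<mapsto> - (\<Sum>n. \<Delta>\<^sup>n f / l\<^sup>n\<^sup>+\<^sup>1)\<close>, with the sign because the spectrum is defined
  by inverting \<open>\<Delta> - l\<close>.
\<close>

lemma quadratic_bound_not_in_spectrum: "l \<notin> l2_spectrum V w \<Delta>"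
proof -
  define R where "R f = (\<lambda>x. - neumann_series l f x)" for f :: "'a \<Rightarrow> real"
  have R: "R f \<in> L2" if "f \<in> L2" for f
    using l2_lincomb[OF neumann_series_l2[OF that] neumann_series_l2[OF that], of "-1" 0]
    by (simp add: R_def)
  have \<Delta>R: "\<Delta> (R f) x - l * R f x = f x" if "f \<in> L2" for f x
    using laplacian_neumann_series[OF that, of x]
      laplacian_lincomb[where a = "-1" and b = 0 and f = "neumann_series l f" and g = f]
    by (simp add: R_def)
  have lin: "R (\<lambda>x. a * f x + b * g x) = (\<lambda>x. a * R f x + b * R g x)"
    if f: "f \<in> L2" and g: "g \<in> L2" for f g a b
  proof (rule shifted_laplacian_inj)
    fix x
    show "l * R (\<lambda>x. a * f x + b * g x) x - \<Delta> (R (\<lambda>x. a * f x + b * g x)) x =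
        l * (a * R f x + b * R g x) - \<Delta> (\<lambda>x. a * R f x + b * R g x) x"
      using \<Delta>R[OF l2_lincomb[OF f g, of a b], of x] \<Delta>R[OF f, of x] \<Delta>R[OF g, of x]
      unfolding laplacian_lincomb by algebra
  qed (intro R l2_lincomb f g)+
  have bounded: "l2_norm V w (R f) \<le> (1 / (l - B)) * l2_norm V w f" if f: "f \<in> L2" for f
  proof -
    have "(l - B)\<^sup>2 * ip (R f) (R f) \<le> ip (\<lambda>x. l * R f x - \<Delta> (R f) x) (\<lambda>x. l * R f x - \<Delta> (R f) x)"
      by (rule shifted_laplacian_coercive[OF R[OF f]])
    also have "(\<lambda>x. l * R f x - \<Delta> (R f) x) = (\<lambda>x. - f x)"
      using \<Delta>R[OF f] by (metis minus_diff_eq)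
    also have "ip (\<lambda>x. - f x) (\<lambda>x. - f x) = ip f f" by (simp add: l2_inner_def)
    finally have "sqrt ((l - B)\<^sup>2 * ip (R f) (R f)) \<le> sqrt (ip f f)" by simp
    then show ?thesis using B_less by (simp add: l2_norm_def real_sqrt_mult field_simps)
  qed
  have inv: "R (\<lambda>x. \<Delta> f x - l * f x) = f" if f: "f \<in> L2" for f
  proof (rule shifted_laplacian_inj)
    have "(\<lambda>x. \<Delta> f x - l * f x) \<in> L2"
      using l2_lincomb[OF laplacian_l2[OF f] f, of 1 "-l"] by simp
    then show "R (\<lambda>x. \<Delta> f x - l * f x) \<in> L2"
        "l * R (\<lambda>x. \<Delta> f x - l * f x) x - \<Delta> (R (\<lambda>x. \<Delta> f x - l * f x)) x = l * f x - \<Delta> f x" for x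
      using R \<Delta>R by (simp_all add: algebra_simps)
  qed (rule f)
  have "l2_bounded_operator V w R"
    unfolding l2_bounded_operator_def using R lin bounded by blast
  then show ?thesis
    unfolding l2_spectrum_def using inv \<Delta>R by blast
qed

end

definition rayleigh_quotients :: "real set"
  where "rayleigh_quotients = {ip (\<Delta> f) f / ip f f | f. f \<in> L2 \<and> 0 < ip f f}"

lemma bdd_above_rayleigh_quotients: "bdd_above rayleigh_quotients"
  unfolding rayleigh_quotients_def
  by (rule bdd_aboveI[of _ 2]) (auto simp: divide_le_eq laplacian_quadratic_bounds(2))

lemma rayleigh_quotients_nonempty: "rayleigh_quotients \<noteq> {}"
proof -
  obtain x where x: "x \<in> V" using infinite by fastforce
  define f where "f = (\<lambda>y. if y = x then 1 else 0 :: real)"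
  have "f \<in> L2" "ip f f = \<mu> x"
    using finite_support_l2[of "{x}" f] x by (auto simp: f_def)
  then show ?thesis using vertex_weight_pos[OF x] unfolding rayleigh_quotients_def by fastforce
qed

lemma laplacian_le_Sup_rayleigh:
  assumes f: "f \<in> L2"
  shows "ip (\<Delta> f) f \<le> Sup rayleigh_quotients * ip f f"
proof (cases "0 < ip f f")
  case True
  then have "ip (\<Delta> f) f / ip f f \<le> Sup rayleigh_quotients"
    using f by (intro cSup_upper bdd_above_rayleigh_quotients) (auto simp: rayleigh_quotients_def)
  then show ?thesis using True by (simp add: divide_le_eq)
next
  case False
  then have "ip f f = 0" using l2_inner_self_nonneg[of f] by simp
  with l2_inner_self_zeroD[OF f this] show ?thesis by (simp add: l2_inner_def)
qed

text \<open>
  Let \<open>M\<close> be the supremum and \<open>A = M - \<Delta> \<ge> 0\<close>. A bounded inverse of \<open>A\<close> would give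
  \<open>ip f f \<le> c * ip (A f) (A f) \<le> 2 * c * ip (A f) f\<close>, so that every Rayleigh quotient would be at
  most \<open>M - 1 / (2 * c)\<close>.
\<close>

lemma Sup_rayleigh_in_spectrum: "Sup rayleigh_quotients \<in> l2_spectrum V w \<Delta>"
proof (rule ccontr)
  let ?M = "Sup rayleigh_quotients"
  assume "?M \<notin> l2_spectrum V w \<Delta>"
  then obtain R where R: "l2_bounded_operator V w R"
    and inv: "\<And>f. f \<in> L2 \<Longrightarrow> R (\<lambda>x. \<Delta> f x - ?M * f x) = f"
    unfolding l2_spectrum_def by auto
  then obtain C where C: "\<And>f. f \<in> L2 \<Longrightarrow> l2_norm V w (R f) \<le> C * l2_norm V w f"
    unfolding l2_bounded_operator_def by blast
  define A where "A f = (\<lambda>x. ?M * f x + (-1) * \<Delta> f x)" for f :: "'a \<Rightarrow> real"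
  have A: "A f \<in> L2" if "f \<in> L2" for f
    unfolding A_def by (intro l2_lincomb laplacian_l2 that)
  have Alin: "A (\<lambda>x. a * f x + b * g x) = (\<lambda>x. a * A f x + b * A g x)" for f g a b
    unfolding A_def laplacian_lincomb by (simp add: algebra_simps)
  have Ainner: "ip (A f) g = ?M * ip f g - ip (\<Delta> f) g" if "f \<in> L2" "g \<in> L2" for f g
    unfolding A_def using that by (subst l2_inner_lincomb_left) (auto intro: laplacian_l2)
  have M2: "?M \<le> 2"
    unfolding rayleigh_quotients_def
    using rayleigh_quotients_nonempty[unfolded rayleigh_quotients_def]
    by (intro cSup_least) (auto simp: divide_le_eq laplacian_quadratic_bounds(2))
  have Asym: "ip (A f) g = ip f (A g)" if "f \<in> L2" "g \<in> L2" for f g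
    using that by (metis Ainner l2_inner_commute laplacian_symmetric)
  have Apos: "0 \<le> ip (A f) f" if "f \<in> L2" for f
    using laplacian_le_Sup_rayleigh[OF that] by (simp add: Ainner that)
  have A2: "ip (A f) f \<le> 2 * ip f f" if "f \<in> L2" for f
    using laplacian_quadratic_bounds(1)[OF that] mult_right_mono[OF M2 l2_inner_self_nonneg[of f]]
    by (simp add: Ainner that)
  \<comment> \<open>The bound \<open>C\<close> of the inverse may be zero, hence the extra \<open>1\<close>.\<close>
  define D where "D = C\<^sup>2 + 1"
  have D: "0 < D" by (simp add: D_def add_nonneg_pos)
  have lower: "ip f f \<le> D * 2 * ip (A f) f" if f: "f \<in> L2" for f
  proof -
    let ?g = "\<lambda>x. \<Delta> f x - ?M * f x"
    have g: "?g \<in> L2" using l2_lincomb[OF laplacian_l2[OF f] f, of 1 "- ?M"] by simp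
    have "(sqrt (ip f f))\<^sup>2 \<le> (C * sqrt (ip ?g ?g))\<^sup>2"
      using C[OF g] inv[OF f] l2_inner_self_nonneg[of f]
      by (intro power_mono) (auto simp: l2_norm_def)
    then have "ip f f \<le> C\<^sup>2 * ip ?g ?g"
      by (simp add: power_mult_distrib l2_inner_self_nonneg)
    also have "ip ?g ?g = ip (A f) (A f)"
      unfolding l2_inner_self_eq A_def by (simp add: power2_commute)
    also have "C\<^sup>2 * ip (A f) (A f) \<le> D * (2 * ip (A f) f)"
      using nonneg_operator_inner_sq_le[OF A Alin Asym Apos A2 _ f] D l2_inner_self_nonneg
      by (intro mult_mono) (auto simp: D_def)
    finally show ?thesis by simp
  qed
  have "?M \<le> ?M - 1 / (2 * D)"
  proof (rule cSup_least[OF rayleigh_quotients_nonempty])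
    fix r assume "r \<in> rayleigh_quotients"
    then obtain f where f: "f \<in> L2" "0 < ip f f" and r: "r = ip (\<Delta> f) f / ip f f"
      by (auto simp: rayleigh_quotients_def)
    have "ip f f / (2 * D) \<le> ?M * ip f f - ip (\<Delta> f) f"
      using lower[OF f(1)] D by (simp add: Ainner f field_simps)
    then have "ip (\<Delta> f) f \<le> (?M - 1 / (2 * D)) * ip f f" by (simp add: algebra_simps)
    then show "r \<le> ?M - 1 / (2 * D)" using f(2) by (simp add: r divide_le_eq)
  qed
  then show False using D by simp
qed

lemma spectrum_bounded:
  assumes "\<And>f. f \<in> L2 \<Longrightarrow> ip (\<Delta> f) f \<le> B * ip f f" "0 < B" "l \<in> l2_spectrum V w \<Delta>"
  shows "l \<le> B"
  using quadratic_bound_not_in_spectrum[of B l] assms by force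

lemma top_of_spectrum_le:
  assumes "\<And>f. f \<in> L2 \<Longrightarrow> ip (\<Delta> f) f \<le> B * ip f f" "0 < B"
  shows "top_of_spectrum V w \<le> B"
  unfolding top_of_spectrum_def
  using Sup_rayleigh_in_spectrum spectrum_bounded[OF assms] by (intro cSup_least) auto

lemma rayleigh_le_top_of_spectrum:
  assumes "f \<in> L2"
  shows "ip (\<Delta> f) f \<le> top_of_spectrum V w * ip f f"
proof -
  have "bdd_above (l2_spectrum V w \<Delta>)"
    by (rule bdd_aboveI[of _ 2], rule spectrum_bounded) (auto intro: laplacian_quadratic_bounds)
  then have "Sup rayleigh_quotients \<le> top_of_spectrum V w"
    unfolding top_of_spectrum_def by (intro cSup_upper Sup_rayleigh_in_spectrum)
  then have "Sup rayleigh_quotients * ip f f \<le> top_of_spectrum V w * ip f f"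
    by (intro mult_right_mono l2_inner_self_nonneg)
  then show ?thesis using laplacian_le_Sup_rayleigh[OF assms] by linarith
qed

section \<open>The Cheeger constants and the lower bound\<close>

lemma edge_weight_eq_sum_Times: "edge_weight w A B = (\<Sum>(x, y)\<in>A \<times> B. w x y)"
  by (simp add: edge_weight_def sum.cartesian_product)

lemma edge_weight_nonneg: "A \<subseteq> V \<Longrightarrow> B \<subseteq> V \<Longrightarrow> 0 \<le> edge_weight w A B"
  unfolding edge_weight_def by (intro sum_nonneg weight_nonneg) auto

lemma vol_eq_edge_weight_boundary:
  assumes "finite U" "U \<subseteq> V"
  shows "vol V w U = edge_weight w U U + boundary_size V w U"
proof -
  have "\<mu> x = (\<Sum>y\<in>U. w x y) + (\<Sum>\<^sub>\<infinity>y\<in>V - U. w x y)" if "x \<in> U" for x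
  proof -
    have x: "x \<in> V" using assms that by auto
    have "infsum (w x) (U \<union> (V - U)) = infsum (w x) U + infsum (w x) (V - U)"
      by (rule infsum_Un_disjoint) (use weight_sum(1)[OF x] assms in auto)
    moreover have "U \<union> (V - U) = V" using assms by auto
    ultimately show ?thesis using assms by (simp add: vertex_weight_def)
  qed
  then show ?thesis
    by (simp add: vol_def edge_weight_def boundary_size_def sum.distrib)
qed

lemma vol_Un_disjoint: "finite A \<Longrightarrow> finite B \<Longrightarrow> A \<inter> B = {} \<Longrightarrow> vol V w (A \<union> B) = vol V w A + vol V w B"
  unfolding vol_def by (rule sum.union_disjoint)

lemma twice_edge_weight_le_vol:
  assumes "A \<subseteq> V" "B \<subseteq> V" "finite A" "finite B"
  shows "2 * edge_weight w A B \<le> vol V w A + vol V w B"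
  using edge_weight_le_vol[of A B] edge_weight_le_vol[of B A] edge_weight_commute[of A B] assms
  by simp

abbreviation "dual_ratios \<equiv> {2 * edge_weight w V\<^sub>1 V\<^sub>2 / (vol V w V\<^sub>1 + vol V w V\<^sub>2) | V\<^sub>1 V\<^sub>2.
      V\<^sub>1 \<noteq> {} \<and> V\<^sub>2 \<noteq> {} \<and> V\<^sub>1 \<inter> V\<^sub>2 = {} \<and> V\<^sub>1 \<subseteq> V \<and> V\<^sub>2 \<subseteq> V \<and> finite V\<^sub>1 \<and> finite V\<^sub>2}"

lemma dual_ratios_bounds:
  assumes "r \<in> dual_ratios"
  shows "0 \<le> r" and "r \<le> 1"
proof -
  obtain A B where r: "r = 2 * edge_weight w A B / (vol V w A + vol V w B)"
    and AB: "A \<noteq> {}" "B \<noteq> {}" "A \<subseteq> V" "B \<subseteq> V" "finite A" "finite B"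
    using assms by blast
  then have "0 < vol V w A + vol V w B" by (intro add_pos_pos vol_pos)
  then show "0 \<le> r" "r \<le> 1"
    using AB twice_edge_weight_le_vol[of A B] edge_weight_nonneg[of A B] by (auto simp: r)
qed

lemma dual_ratios_nonempty: "dual_ratios \<noteq> {}"
proof -
  obtain x where x: "x \<in> V" using infinite by fastforce
  have "infinite (V - {x})" using infinite by simp
  then have "V - {x} \<noteq> {}" by (metis finite.emptyI)
  then obtain y where "y \<in> V - {x}" by blast
  with x have "{x} \<noteq> {} \<and> {y} \<noteq> {} \<and> {x} \<inter> {y} = {} \<and> {x} \<subseteq> V \<and> {y} \<subseteq> V \<and> finite {x} \<and> finite {y}"
    by simp
  then show ?thesis by blast
qed

lemma bdd_above_dual_ratios: "bdd_above dual_ratios"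
  by (rule bdd_aboveI) (rule dual_ratios_bounds(2))

lemma dual_cheeger_bounds: "0 \<le> dual_cheeger V w V" "dual_cheeger V w V \<le> 1"
proof -
  obtain r where r: "r \<in> dual_ratios" using dual_ratios_nonempty by blast
  then have "0 \<le> r" by (rule dual_ratios_bounds(1))
  also have "r \<le> dual_cheeger V w V"
    unfolding dual_cheeger_def by (rule cSup_upper[OF r bdd_above_dual_ratios])
  finally show "0 \<le> dual_cheeger V w V" .
  show "dual_cheeger V w V \<le> 1"
    unfolding dual_cheeger_def by (rule cSup_least[OF dual_ratios_nonempty dual_ratios_bounds(2)])
qed

text \<open>
  Unlike in the definition of the constant, one of the parts may be empty here. The level sets
  below need this: a function may have constant sign.
\<close>

lemma edge_weight_le_dual_cheeger:
  assumes "A \<subseteq> V" "B \<subseteq> V" "finite A" "finite B" "A \<inter> B = {}"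
  shows "2 * edge_weight w A B \<le> dual_cheeger V w V * vol V w (A \<union> B)"
proof (cases "A = {} \<or> B = {}")
  case True
  then have "edge_weight w A B = 0" by (auto simp: edge_weight_def)
  then show ?thesis using assms dual_cheeger_bounds vol_nonneg by simp
next
  case False
  then have "2 * edge_weight w A B / (vol V w A + vol V w B) \<in> dual_ratios" using assms by blast
  then have "2 * edge_weight w A B / (vol V w A + vol V w B) \<le> dual_cheeger V w V"
    unfolding dual_cheeger_def by (rule cSup_upper[OF _ bdd_above_dual_ratios])
  moreover have "0 < vol V w A + vol V w B" using False assms vol_pos by (simp add: add_pos_pos)
  ultimately show ?thesis using assms by (simp add: vol_Un_disjoint divide_le_eq)
qed

lemma cheeger_le_boundary:
  assumes "finite U" "U \<subseteq> V" "U \<noteq> {}"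
  shows "cheeger V w V * vol V w U \<le> boundary_size V w U"
proof -
  have "cheeger V w V \<le> boundary_size V w U / vol V w U"
    unfolding cheeger_def
  proof (rule cInf_lower)
    show "bdd_below {boundary_size V w U / vol V w U |U. U \<noteq> {} \<and> U \<subseteq> V \<and> finite U}"
      by (rule bdd_belowI[of _ 0]) (auto simp: boundary_size_nonneg vol_nonneg)
  qed (use assms in blast)
  then show ?thesis using vol_pos[of U] assms by (simp add: le_divide_eq)
qed

text \<open>
  The test function is \<open>f = 1\<close> on \<open>A\<close>, \<open>f = -1\<close> on \<open>B\<close>, zero elsewhere. An edge between \<open>A\<close> and
  \<open>B\<close> has gradient \<open>2\<close>, an edge leaving \<open>A \<union> B\<close> has gradient \<open>1\<close>, and the others contribute nothing.
  Hence the Rayleigh quotient is \<open>(4 * |E(A, B)| + |\<partial>(A \<union> B)|) / vol (A \<union> B)\<close>, and its two parts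
  are bounded below separately by choosing \<open>A\<close> and \<open>B\<close> nearly optimal for the dual constant and
  by the Cheeger constant of \<open>A \<union> B\<close>.
\<close>

lemma cheeger_constants_le_top_of_spectrum: "2 * dual_cheeger V w V + cheeger V w V \<le> top_of_spectrum V w"
proof -
  let ?h = "cheeger V w V" and ?t = "top_of_spectrum V w"
  have "r \<le> (?t - ?h) / 2" if r_in: "r \<in> dual_ratios" for r
  proof -
    obtain A B where r: "r = 2 * edge_weight w A B / (vol V w A + vol V w B)"
      and AB: "A \<noteq> {}" "B \<noteq> {}" "A \<inter> B = {}" "A \<subseteq> V" "B \<subseteq> V" "finite A" "finite B"
      using r_in by blast
    let ?U = "A \<union> B"
    have U: "finite ?U" "?U \<subseteq> V" "?U \<noteq> {}" using AB by auto
    define f :: "'a \<Rightarrow> real" where "f x = (if x \<in> A then 1 else if x \<in> B then - 1 else 0)" for x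
    have fA: "f x = 1" if "x \<in> A" for x using that by (simp add: f_def)
    have fB: "f x = - 1" if "x \<in> B" for x using that AB by (auto simp: f_def)
    have supp: "f x = 0" if "x \<notin> ?U" for x using that by (simp add: f_def)
    have f: "f \<in> L2" by (rule finite_support_l2[OF U(1,2) supp])
    have ff: "ip f f = vol V w ?U"
    proof -
      have "ip f f = (\<Sum>x\<in>?U. \<mu> x * (f x)\<^sup>2)"
        by (rule finite_support_l2(2)[OF U(1,2)]) (rule supp)
      also have "\<dots> = vol V w ?U" unfolding vol_def by (rule sum.cong) (auto simp: fA fB)
      finally show ?thesis .
    qed
    have split: "sum g (?U \<times> ?U) = sum g (A \<times> A) + sum g (A \<times> B) + sum g (B \<times> A) + sum g (B \<times> B)"
      for g :: "'a \<times> 'a \<Rightarrow> real"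
    proof -
      have "?U \<times> ?U = ((A \<times> A) \<union> (A \<times> B)) \<union> ((B \<times> A) \<union> (B \<times> B))" by auto
      also have "sum g \<dots> = sum g ((A \<times> A) \<union> (A \<times> B)) + sum g ((B \<times> A) \<union> (B \<times> B))"
        using AB by (intro sum.union_disjoint) auto
      also have "\<dots> = (sum g (A \<times> A) + sum g (A \<times> B)) + (sum g (B \<times> A) + sum g (B \<times> B))"
        using AB by (intro arg_cong2[where f = "(+)"] sum.union_disjoint) auto
      finally show ?thesis by simp
    qed
    have "nbr_form f f = (\<Sum>(x, y)\<in>?U \<times> ?U. w x y * (f x * f y))"
      by (rule finite_support_nbr_form[OF U(1,2) supp])
    also have "\<dots> = (\<Sum>(x, y)\<in>A \<times> A. w x y) + (\<Sum>(x, y)\<in>A \<times> B. - w x y)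
        + (\<Sum>(x, y)\<in>B \<times> A. - w x y) + (\<Sum>(x, y)\<in>B \<times> B. w x y)"
      unfolding split by (intro arg_cong2[where f = "(+)"] sum.cong) (auto simp: fA fB)
    also have "\<dots> = edge_weight w A A - 2 * edge_weight w A B + edge_weight w B B"
      using edge_weight_commute[of B A] AB
      by (simp add: edge_weight_eq_sum_Times case_prod_unfold sum_negf)
    finally have nf: "nbr_form f f = edge_weight w A A - 2 * edge_weight w A B + edge_weight w B B" .
    have "vol V w ?U = edge_weight w A A + 2 * edge_weight w A B + edge_weight w B B + boundary_size V w ?U"
      unfolding vol_eq_edge_weight_boundary[OF U(1,2)] edge_weight_eq_sum_Times[of ?U] split
      using edge_weight_commute[of B A] AB by (simp flip: edge_weight_eq_sum_Times)
    then have "4 * edge_weight w A B + boundary_size V w ?U = ip (\<Delta> f) f"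
      by (simp add: laplacian_inner f ff nf)
    also have "\<dots> \<le> ?t * vol V w ?U"
      using rayleigh_le_top_of_spectrum[OF f] by (simp add: ff)
    finally have "4 * edge_weight w A B \<le> (?t - ?h) * vol V w ?U"
      using cheeger_le_boundary[OF U] by (simp add: algebra_simps)
    then show ?thesis
      using vol_pos[OF U(2,1,3)] AB by (simp add: r vol_Un_disjoint field_simps)
  qed
  then have "dual_cheeger V w V \<le> (?t - ?h) / 2"
    unfolding dual_cheeger_def by (intro cSup_least[OF dual_ratios_nonempty])
  then show ?thesis by simp
qed

section \<open>The dual Cheeger inequality\<close>

text \<open>
  A co-area argument. For the indicator \<open>g\<close> of a set, split by \<open>s\<close> into two parts, this is the
  definition of the dual Cheeger constant. Both sides are additive over level sets, since
  \<open>min (g x) (g y)\<close> is the length of the set of levels \<open>t\<close> with \<open>t < g x\<close> and \<open>t < g y\<close>. In place of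
  an integral over \<open>t\<close>, the induction peels off the lowest level: it subtracts the smallest
  positive value of \<open>g\<close> on the whole support of \<open>g\<close>.
\<close>

lemma dual_cheeger_level_sets:
  fixes g :: "'a \<Rightarrow> real" and s :: "'a \<Rightarrow> bool"
  assumes F: "finite F" "F \<subseteq> V" and "\<And>x. x \<in> F \<Longrightarrow> 0 \<le> g x"
  shows "(\<Sum>(x, y) | x \<in> F \<and> y \<in> F \<and> s x \<noteq> s y. w x y * min (g x) (g y))
    \<le> dual_cheeger V w V * (\<Sum>x\<in>F. \<mu> x * g x)"
  using assms(3)
proof (induction "card {x \<in> F. 0 < g x}" arbitrary: g rule: less_induct)
  case less
  let ?O = "{(x, y). x \<in> F \<and> y \<in> F \<and> s x \<noteq> s y}" and ?hb = "dual_cheeger V w V"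
  let ?U = "{x \<in> F. 0 < g x}"
  have finO: "finite ?O" by (rule finite_subset[of _ "F \<times> F"]) (use F in auto)
  show ?case
  proof (cases "?U = {}")
    case True
    then have "g x = 0" if "x \<in> F" for x using less.prems[OF that] that by fastforce
    then have "(\<Sum>(x, y)\<in>?O. w x y * min (g x) (g y)) = 0" "(\<Sum>x\<in>F. \<mu> x * g x) = 0"
      by (auto intro!: sum.neutral)
    then show ?thesis by simp
  next
    case False
    define m where "m = Min (g ` ?U)"
    have finU: "finite ?U" using F by simp
    have m: "m \<in> g ` ?U" "\<And>x. x \<in> ?U \<Longrightarrow> m \<le> g x"
      unfolding m_def using finU False by auto
    then have m0: "0 < m" by auto
    define g' where "g' x = (if x \<in> ?U then g x - m else g x)" for x
    have g'0: "0 \<le> g' x" if "x \<in> F" for x using m(2) less.prems that by (auto simp: g'_def)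
    have "{x \<in> F. 0 < g' x} \<subset> ?U"
    proof -
      obtain x where "x \<in> ?U" "g x = m" using m(1) by auto
      then have "x \<notin> {x \<in> F. 0 < g' x}" "x \<in> ?U" by (auto simp: g'_def)
      moreover have "{x \<in> F. 0 < g' x} \<subseteq> ?U" by (auto simp: g'_def)
      ultimately show ?thesis by blast
    qed
    then have "card {x \<in> F. 0 < g' x} < card ?U" using finU by (rule psubset_card_mono[rotated])
    from less.hyps[OF this g'0]
    have IH: "(\<Sum>(x, y)\<in>?O. w x y * min (g' x) (g' y)) \<le> ?hb * (\<Sum>x\<in>F. \<mu> x * g' x)" .
    let ?A = "{x \<in> ?U. s x}" and ?B = "{x \<in> ?U. \<not> s x}"
    have AB: "?A \<subseteq> V" "?B \<subseteq> V" "finite ?A" "finite ?B" "?A \<inter> ?B = {}" using F by auto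
    have AB_U: "?A \<union> ?B = ?U" by blast
    have "(\<Sum>(x, y)\<in>?O. if x \<in> ?U \<and> y \<in> ?U then w x y else 0) = (\<Sum>(x, y)\<in>?A \<times> ?B \<union> ?B \<times> ?A. w x y)"
      by (rule sum.mono_neutral_cong_right[OF finO]) (auto simp: case_prod_unfold)
    also have "\<dots> = edge_weight w ?A ?B + edge_weight w ?B ?A"
      unfolding edge_weight_eq_sum_Times using AB by (intro sum.union_disjoint) auto
    also have "\<dots> = 2 * edge_weight w ?A ?B" using edge_weight_commute[OF AB(1,2)] by simp
    also have "\<dots> \<le> ?hb * vol V w ?U"
      using edge_weight_le_dual_cheeger[OF AB] unfolding AB_U .
    finally have level: "(\<Sum>(x, y)\<in>?O. if x \<in> ?U \<and> y \<in> ?U then w x y else 0) \<le> ?hb * vol V w ?U" .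
    have "(\<Sum>(x, y)\<in>?O. w x y * min (g x) (g y)) =
        (\<Sum>(x, y)\<in>?O. w x y * min (g' x) (g' y) + m * (if x \<in> ?U \<and> y \<in> ?U then w x y else 0))"
    proof (intro sum.cong refl, clarify)
      fix x y assume "x \<in> F" "y \<in> F"
      then have "min (g x) (g y) = min (g' x) (g' y) + (if x \<in> ?U \<and> y \<in> ?U then m else 0)"
        using less.prems[of x] less.prems[of y] m(2)[of x] m(2)[of y] by (auto simp: g'_def)
      then show "w x y * min (g x) (g y) =
          w x y * min (g' x) (g' y) + m * (if x \<in> ?U \<and> y \<in> ?U then w x y else 0)"
        by (simp add: algebra_simps)
    qed
    also have "\<dots> = (\<Sum>(x, y)\<in>?O. w x y * min (g' x) (g' y))
        + m * (\<Sum>(x, y)\<in>?O. if x \<in> ?U \<and> y \<in> ?U then w x y else 0)"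
      by (simp add: case_prod_unfold sum.distrib sum_distrib_left)
    also have "\<dots> \<le> ?hb * (\<Sum>x\<in>F. \<mu> x * g' x) + m * (?hb * vol V w ?U)"
      using IH level m0 by (intro add_mono mult_left_mono) auto
    also have "\<dots> = ?hb * ((\<Sum>x\<in>F. \<mu> x * g' x) + m * vol V w ?U)"
      by (simp add: algebra_simps)
    also have "m * vol V w ?U = (\<Sum>x\<in>F. if x \<in> ?U then m * \<mu> x else 0)"
      unfolding vol_def sum_distrib_left
      by (rule sum.mono_neutral_cong_left) (use F in auto)
    also have "(\<Sum>x\<in>F. \<mu> x * g' x) + \<dots> = (\<Sum>x\<in>F. \<mu> x * g x)"
      unfolding sum.distrib[symmetric]
      by (intro sum.cong) (auto simp: g'_def algebra_simps)
    finally show ?thesis .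
  qed
qed

text \<open>
  Only pairs on which \<open>f\<close> changes sign can raise the Rayleigh quotient above \<open>1\<close>, so it is at most
  \<open>(N + D) / N\<close>, where \<open>D\<close> sums \<open>w x y * \<bar>f x * f y\<bar>\<close> over these pairs. With \<open>S\<close> and \<open>\<Psi>\<close> the sums of
  \<open>w x y * ((f x)\<^sup>2 + (f y)\<^sup>2) / 2\<close> and of \<open>w x y * min ((f x)\<^sup>2) ((f y)\<^sup>2)\<close> over the same pairs,
  Cauchy-Schwarz gives \<open>(S - \<Psi>)\<^sup>2 \<le> (S - D) * (S + D)\<close>. As \<open>S \<le> N\<close>, this implies
  \<open>(N - \<Psi>)\<^sup>2 \<le> (N - D) * (N + D)\<close>. The level set lemma for \<open>g = f\<^sup>2\<close> says \<open>\<Psi> \<le> h * N\<close> with the dual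
  Cheeger constant \<open>h\<close>, so \<open>D\<^sup>2 \<le> (1 - (1 - h)\<^sup>2) * N\<^sup>2\<close>.

  On pairs of equal sign \<open>(\<bar>f x\<bar> + \<bar>f y\<bar>)\<^sup>2\<close> exceeds \<open>(f x - f y)\<^sup>2\<close>, which spoils Cauchy-Schwarz over
  all pairs. These pairs therefore enter only through the slack \<open>N - S \<ge> 0\<close>, as does the weight of
  edges that leave \<open>F\<close>.
\<close>

lemma dual_cheeger_finite_inequality:
  fixes f :: "'a \<Rightarrow> real"
  assumes F: "finite F" "F \<subseteq> V"
  defines "N \<equiv> \<Sum>x\<in>F. \<mu> x * (f x)\<^sup>2"
  shows "N - (\<Sum>(x, y)\<in>F \<times> F. w x y * (f x * f y))
    \<le> (1 + sqrt (1 - (1 - dual_cheeger V w V)\<^sup>2)) * N"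
proof -
  let ?hb = "dual_cheeger V w V"
  define P where "P = {(x, y). x \<in> F \<and> y \<in> F \<and> (0 < f x) \<noteq> (0 < f y)}"
  have P: "P \<subseteq> F \<times> F" "finite P"
    unfolding P_def using F by (auto intro: finite_subset[of _ "F \<times> F"])
  have w0: "0 \<le> w x y" if "x \<in> F" "y \<in> F" for x y using that F weight_nonneg by auto
  define D S \<Psi> where "D = (\<Sum>(x, y)\<in>P. w x y * (\<bar>f x\<bar> * \<bar>f y\<bar>))"
    and "S = (\<Sum>(x, y)\<in>P. w x y * (((f x)\<^sup>2 + (f y)\<^sup>2) / 2))"
    and "\<Psi> = (\<Sum>(x, y)\<in>P. w x y * min ((f x)\<^sup>2) ((f y)\<^sup>2))"
  have N0: "0 \<le> N" unfolding N_def using F less_imp_le[OF vertex_weight_pos] by (intro sum_nonneg) auto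
  have \<Psi>0: "0 \<le> \<Psi>" unfolding \<Psi>_def using P w0 by (intro sum_nonneg) auto
  \<comment> \<open>An inequality only, since edges may leave \<open>F\<close>.\<close>
  have half: "(\<Sum>x\<in>F. \<Sum>y\<in>F. w x y * (f x)\<^sup>2) \<le> N"
    unfolding N_def
  proof (rule sum_mono)
    fix x assume x: "x \<in> F"
    then have "sum (w x) F \<le> \<mu> x"
      unfolding vertex_weight_def using F weight_sum(2)[of x V F] by auto
    then show "(\<Sum>y\<in>F. w x y * (f x)\<^sup>2) \<le> \<mu> x * (f x)\<^sup>2"
      by (simp flip: sum_distrib_right) (intro mult_right_mono, auto)
  qed
  have half': "(\<Sum>x\<in>F. \<Sum>y\<in>F. w x y * (f y)\<^sup>2) = (\<Sum>x\<in>F. \<Sum>y\<in>F. w x y * (f x)\<^sup>2)"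
    by (subst sum.swap) (intro sum.cong refl arg_cong2[where f = "(*)"] weight_sym; use F in auto)
  have "S \<le> (\<Sum>(x, y)\<in>F \<times> F. w x y * (((f x)\<^sup>2 + (f y)\<^sup>2) / 2))"
    unfolding S_def using P F w0 by (intro sum_mono2) auto
  also have "\<dots> = ((\<Sum>x\<in>F. \<Sum>y\<in>F. w x y * (f x)\<^sup>2) + (\<Sum>x\<in>F. \<Sum>y\<in>F. w x y * (f y)\<^sup>2)) / 2"
    by (simp add: sum.cartesian_product[symmetric] distrib_left sum.distrib sum_divide_distrib add_divide_distrib)
  finally have SN: "S \<le> N" using half half' by simp
  have "(\<Sum>(x, y)\<in>F \<times> F. - (w x y * (f x * f y))) \<le> D"
  proof -
    have "(\<Sum>(x, y)\<in>F \<times> F. - (w x y * (f x * f y))) \<le>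
        (\<Sum>(x, y)\<in>F \<times> F. if (x, y) \<in> P then w x y * (\<bar>f x\<bar> * \<bar>f y\<bar>) else 0)"
    proof (intro sum_mono, clarify)
      fix x y assume xy: "x \<in> F" "y \<in> F"
      show "- (w x y * (f x * f y)) \<le> (if (x, y) \<in> P then w x y * (\<bar>f x\<bar> * \<bar>f y\<bar>) else 0)"
      proof (cases "(x, y) \<in> P")
        case True
        have "w x y * (- (f x * f y)) \<le> w x y * (\<bar>f x\<bar> * \<bar>f y\<bar>)"
          using w0[OF xy] by (intro mult_left_mono) (auto simp flip: abs_mult)
        then show ?thesis using True by simp
      next
        case False
        then have "0 \<le> f x * f y"
          using xy by (auto simp: P_def zero_le_mult_iff not_less)
        then show ?thesis using False w0[OF xy] by simp
      qed
    qed
    also have "\<dots> = D"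
      unfolding D_def by (rule sum.mono_neutral_cong_right) (use P F in auto)
    finally show ?thesis .
  qed
  then have ND: "N - (\<Sum>(x, y)\<in>F \<times> F. w x y * (f x * f y)) \<le> N + D"
    by (simp add: case_prod_unfold sum_negf)
  have CS: "(S - \<Psi>)\<^sup>2 \<le> (S - D) * (S + D)"
  proof -
    define a b where "a = (\<lambda>(x, y). sqrt (w x y / 2) * \<bar>\<bar>f x\<bar> - \<bar>f y\<bar>\<bar>)"
      and "b = (\<lambda>(x, y). sqrt (w x y / 2) * (\<bar>f x\<bar> + \<bar>f y\<bar>))"
    have root: "sqrt (w x y / 2) * sqrt (w x y / 2) = w x y / 2" if "(x, y) \<in> P" for x y
      using w0 P(1) that by auto
    have "S - \<Psi> = (\<Sum>p\<in>P. a p * b p)"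
      unfolding S_def \<Psi>_def sum_subtractf[symmetric]
    proof (intro sum.cong refl, clarify)
      fix x y assume xy: "(x, y) \<in> P"
      have "a (x, y) * b (x, y) =
          (sqrt (w x y / 2) * sqrt (w x y / 2)) * (\<bar>\<bar>f x\<bar> - \<bar>f y\<bar>\<bar> * (\<bar>f x\<bar> + \<bar>f y\<bar>))"
        unfolding a_def b_def prod.case by (simp only: ac_simps)
      also note root[OF xy]
      also have "\<bar>\<bar>f x\<bar> - \<bar>f y\<bar>\<bar> * (\<bar>f x\<bar> + \<bar>f y\<bar>) = \<bar>(\<bar>f x\<bar> - \<bar>f y\<bar>) * (\<bar>f x\<bar> + \<bar>f y\<bar>)\<bar>"
        by (simp add: abs_mult)
      also have "(\<bar>f x\<bar> - \<bar>f y\<bar>) * (\<bar>f x\<bar> + \<bar>f y\<bar>) = (f x)\<^sup>2 - (f y)\<^sup>2"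
        by (simp add: algebra_simps power2_eq_square)
      also have "\<bar>(f x)\<^sup>2 - (f y)\<^sup>2\<bar> = (f x)\<^sup>2 + (f y)\<^sup>2 - 2 * min ((f x)\<^sup>2) ((f y)\<^sup>2)"
        by (simp add: min_def abs_if)
      finally show "w x y * (((f x)\<^sup>2 + (f y)\<^sup>2) / 2) - w x y * min ((f x)\<^sup>2) ((f y)\<^sup>2) = a (x, y) * b (x, y)"
        by (simp add: algebra_simps)
    qed
    moreover have "S - D = (\<Sum>p\<in>P. (a p)\<^sup>2)"
      unfolding S_def D_def sum_subtractf[symmetric]
    proof (intro sum.cong refl, clarify)
      fix x y assume xy: "(x, y) \<in> P"
      have "(a (x, y))\<^sup>2 = (sqrt (w x y / 2) * sqrt (w x y / 2)) * (\<bar>f x\<bar> - \<bar>f y\<bar>)\<^sup>2"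
        unfolding a_def prod.case power_mult_distrib power2_abs by (simp only: power2_eq_square)
      also note root[OF xy]
      finally show "w x y * (((f x)\<^sup>2 + (f y)\<^sup>2) / 2) - w x y * (\<bar>f x\<bar> * \<bar>f y\<bar>) = (a (x, y))\<^sup>2"
        by (simp add: power2_diff field_simps)
    qed
    moreover have "S + D = (\<Sum>p\<in>P. (b p)\<^sup>2)"
      unfolding S_def D_def sum.distrib[symmetric]
    proof (intro sum.cong refl, clarify)
      fix x y assume xy: "(x, y) \<in> P"
      have "(b (x, y))\<^sup>2 = (sqrt (w x y / 2) * sqrt (w x y / 2)) * (\<bar>f x\<bar> + \<bar>f y\<bar>)\<^sup>2"
        unfolding b_def prod.case power_mult_distrib by (simp only: power2_eq_square)
      also note root[OF xy]
      finally show "w x y * (((f x)\<^sup>2 + (f y)\<^sup>2) / 2) + w x y * (\<bar>f x\<bar> * \<bar>f y\<bar>) = (b (x, y))\<^sup>2"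
        by (simp add: power2_sum field_simps)
    qed
    ultimately show ?thesis using Cauchy_Schwarz_ineq_sum[of a b P] by simp
  qed
  \<comment> \<open>Replacing \<open>S\<close> by \<open>N\<close> on both sides of \<open>CS\<close> adds exactly this much more to the right.\<close>
  have "0 \<le> 2 * (N - S) * \<Psi>" using SN \<Psi>0 by simp
  with CS have "(N - \<Psi>)\<^sup>2 \<le> N\<^sup>2 - D\<^sup>2"
    by (simp add: power2_eq_square algebra_simps)
  moreover have "((1 - ?hb) * N)\<^sup>2 \<le> (N - \<Psi>)\<^sup>2"
  proof (rule power_mono)
    have "\<Psi> \<le> ?hb * N"
      unfolding \<Psi>_def P_def N_def by (rule dual_cheeger_level_sets[OF F]) simp
    then show "(1 - ?hb) * N \<le> N - \<Psi>" by (simp add: algebra_simps)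
    show "0 \<le> (1 - ?hb) * N" using N0 dual_cheeger_bounds by simp
  qed
  ultimately have "D\<^sup>2 \<le> (1 - (1 - ?hb)\<^sup>2) * N\<^sup>2"
    unfolding power_mult_distrib by (simp add: left_diff_distrib)
  then have "D \<le> sqrt ((1 - (1 - ?hb)\<^sup>2) * N\<^sup>2)" by (rule real_le_rsqrt)
  also have "\<dots> = sqrt (1 - (1 - ?hb)\<^sup>2) * N" using N0 by (simp add: real_sqrt_mult)
  finally show ?thesis using ND by (simp add: algebra_simps)
qed

text \<open>
  A square-summable function may exceed a positive level at infinitely many vertices, because
  vertex weights may tend to zero, and the constants are defined by finite sets. The dual Cheeger inequality is therefore proved for
  finite truncations and transferred along an exhaustion.
\<close>

lemma laplacian_quadratic_le_if_finite:
  assumes fin: "\<And>F. finite F \<Longrightarrow> F \<subseteq> V \<Longrightarrow>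
      (\<Sum>x\<in>F. \<mu> x * (f x)\<^sup>2) - (\<Sum>(x, y)\<in>F \<times> F. w x y * (f x * f y)) \<le> B * (\<Sum>x\<in>F. \<mu> x * (f x)\<^sup>2)"
    and f: "f \<in> L2"
  shows "ip (\<Delta> f) f \<le> B * ip f f"
proof -
  obtain \<Omega> where \<Omega>: "exhaustion V \<Omega>" using exhaustion_exists by blast
  then have fin\<Omega>: "finite (\<Omega> n)" "\<Omega> n \<subseteq> V" for n unfolding exhaustion_def by auto
  have "((\<lambda>x. \<mu> x * (f x)\<^sup>2) has_sum ip f f) V"
    unfolding l2_inner_self_eq using f by (intro has_sum_infsum l2_sq_summable)
  then have N: "(\<lambda>n. \<Sum>x\<in>\<Omega> n. \<mu> x * (f x)\<^sup>2) \<longlonglongrightarrow> ip f f"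
    using fin\<Omega> finite_subset_exhaustion[OF \<Omega>] by (intro has_sum_exhaustion)
  have K: "(\<lambda>n. \<Sum>(x, y)\<in>\<Omega> n \<times> \<Omega> n. w x y * (f x * f y)) \<longlonglongrightarrow> nbr_form f f"
  proof (rule has_sum_exhaustion[OF nbr_form_has_sum[OF f f]])
    fix X assume X: "finite X" "X \<subseteq> V \<times> V"
    then have "finite (fst ` X \<union> snd ` X)" "fst ` X \<union> snd ` X \<subseteq> V" by auto
    from finite_subset_exhaustion[OF \<Omega> this] show "\<forall>\<^sub>F n in sequentially. X \<subseteq> \<Omega> n \<times> \<Omega> n"
      by eventually_elim force
  qed (use fin\<Omega> in auto)
  have "ip f f - nbr_form f f \<le> B * ip f f"
    by (rule LIMSEQ_le[OF tendsto_diff[OF N K] tendsto_mult[OF tendsto_const N]])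
      (use fin fin\<Omega> in blast)
  then show ?thesis by (simp add: laplacian_inner f)
qed

end

theorem theorem7p1:
  fixes V :: "'a set" and E :: "('a \<times> 'a) set" and w :: "'a \<Rightarrow> 'a \<Rightarrow> real"
  assumes "infinite_weighted_graph V E w"
  shows "2 * dual_cheeger_graph V w + cheeger_graph V w \<le> top_of_spectrum V w \<and>
    top_of_spectrum V w \<le> 1 + sqrt (1 - (1 - dual_cheeger_graph V w)\<^sup>2)"
proof -
  interpret infinite_weighted_graph V E w by fact
  let ?B = "1 + sqrt (1 - (1 - dual_cheeger V w V)\<^sup>2)"
  have "(1 - dual_cheeger V w V)\<^sup>2 \<le> 1"
    using dual_cheeger_bounds by (intro power_le_one) auto
  then have "0 < ?B" by (simp add: add_pos_nonneg)
  moreover have "l2_inner V w (laplacian V w f) f \<le> ?B * l2_inner V w f f" if "f \<in> l2_space V w" for f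
    using dual_cheeger_finite_inequality that by (rule laplacian_quadratic_le_if_finite)
  ultimately have "top_of_spectrum V w \<le> ?B" by (intro top_of_spectrum_le)
  then show ?thesis
    using cheeger_constants_le_top_of_spectrum by (simp add: dual_cheeger_graph_eq cheeger_graph_eq)
qed

end
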